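(* Let $\mathcal{X} \subset \mathbb{C}$ be a compact set with $\mathrm{cap}(\mathcal{X}) > 0$. Then there is a function $\varepsilon_{\mathcal{X}} : \mathbb{N} \to \mathbb{R}$, depending only on $\mathcal{X}$, with $\varepsilon_{\mathcal{X}}(l) \to 0$ as $l \to \infty$, such that the following holds. Let $n, k \geq 1$ be integers, let $A \in \mathbb{C}^{n \times n}$ be diagonalizable with $VAV^{-1} = D$ for an invertible $V$ and a diagonal $D$, and suppose all eigenvalues of $A$ lie in $\mathcal{X}$. Let $B \in \mathbb{C}^{n \times k}$ and $t_{\min} := \lceil n/k \rceil - 1$. Then \[ \lambda_{\min}\big(W(t_{\min})\big) \leq \mathrm{cond}^2(V)\, \|B\|_F^2 \, \Big( \big(1 + \varepsilon_{\mathcal{X}}(t_{\min})\big)\, \mathrm{cap}^2(\mathcal{X}) \Big)^{t_{\min}}. \]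
   Context: For $A \in \mathbb{C}^{n\times n}$, $B \in \mathbb{C}^{n \times k}$ and an integer $t \ge 0$, the $t$-step controllability Gramian is $W(t) := \sum_{i=0}^{t} A^i B B^* (A^* )^i$, where $^*$ denotes conjugate transpose; $\lambda_{\min}$ denotes the smallest eigenvalue of this positive semidefinite Hermitian matrix. $\mathrm{cond}(V) := \|V\|_2 \|V^{-1}\|_2$ (spectral norms), and $\|B\|_F$ is the Frobenius norm. For a compact set $K \subset \mathbb{C}$, let $I(K) := \sup_{\mu} \int_{K\times K} \log|z-w|\, d\mu(z)\, d\mu(w)$, the supremum over Borel probability measures $\mu$ supported on $K$; the logarithmic capacity is $\mathrm{cap}(K) := e^{I(K)}$. *)

theory Defs
  imports "HOL-Probability.Probability" "Jordan_Normal_Form.Schur_Decomposition"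
begin

definition prob_measures_on :: "complex set \<Rightarrow> complex measure set" where
  "prob_measures_on K = {\<mu>. sets \<mu> = sets borel \<and> prob_space \<mu> \<and> emeasure \<mu> (UNIV - K) = 0}"

text \<open>The logarithmic energy integral of mu, as an extended real: the integrand
  log|z-w| (with value minus infinity on the diagonal) is split into its positive
  and negative parts, each integrated as a nonnegative integral over mu x mu.\<close>
definition log_energy :: "complex measure \<Rightarrow> ereal" where
  "log_energy \<mu> =
     (enn2ereal (\<integral>\<^sup>+ p. ennreal (max 0 (ln (cmod (fst p - snd p)))) \<partial>(\<mu> \<Otimes>\<^sub>M \<mu>))
      - enn2ereal (\<integral>\<^sup>+ p. (if fst p = snd p then \<infinity>
                             else ennreal (max 0 (- ln (cmod (fst p - snd p))))) \<partial>(\<mu> \<Otimes>\<^sub>M \<mu>)))"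

definition log_energy_sup :: "complex set \<Rightarrow> ereal" where
  "log_energy_sup K = (SUP \<mu>\<in>prob_measures_on K. log_energy \<mu>)"

definition log_capacity :: "complex set \<Rightarrow> real" where
  "log_capacity K = (if log_energy_sup K = - \<infinity> then 0 else exp (real_of_ereal (log_energy_sup K)))"

definition vec_2norm :: "complex vec \<Rightarrow> real" where
  "vec_2norm x = sqrt (\<Sum>i<dim_vec x. (cmod (x $ i))\<^sup>2)"

definition spec_norm :: "complex mat \<Rightarrow> real" where
  "spec_norm M = (SUP x\<in>{x. x \<in> carrier_vec (dim_col M) \<and> vec_2norm x \<le> 1}. vec_2norm (M *\<^sub>v x))"

definition frob_norm :: "complex mat \<Rightarrow> real" where
  "frob_norm M = sqrt (\<Sum>i<dim_row M. \<Sum>j<dim_col M. (cmod (M $$ (i, j)))\<^sup>2)"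

definition mat_inv :: "complex mat \<Rightarrow> complex mat" where
  "mat_inv V = (SOME W. inverts_mat V W \<and> inverts_mat W V)"

definition cond_num :: "complex mat \<Rightarrow> real" where
  "cond_num V = spec_norm V * spec_norm (mat_inv V)"

text \<open>Smallest eigenvalue of a Hermitian matrix (eigenvalues are real).\<close>
definition lambda_min :: "complex mat \<Rightarrow> real" where
  "lambda_min W = Min (Re ` {e. eigenvalue W e})"

definition ctrl_gramian :: "complex mat \<Rightarrow> complex mat \<Rightarrow> nat \<Rightarrow> complex mat" where
  "ctrl_gramian A B t = mat (dim_row A) (dim_row A)
     (\<lambda>(i, j). \<Sum>l\<le>t. (A ^\<^sub>m l * B * mat_adjoint B * (mat_adjoint A) ^\<^sub>m l) $$ (i, j))"

end

theory Submission
  imports Defs "Jordan_Normal_Form.Spectral_Radius"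
begin

text \<open>
  Since \<open>k * t < n\<close>, there is a unit vector \<open>x\<close> orthogonal to the columns of \<open>A ^ l * B\<close> for all
  \<open>l < t\<close>. In the Rayleigh quotient of the Gramian at \<open>x\<close> only the term \<open>l = t\<close> survives, and there
  \<open>A ^ t\<close> may be replaced by \<open>p(A)\<close> for any monic polynomial \<open>p\<close> of degree \<open>t\<close>. Diagonalization
  bounds this term by the squared maximum of \<open>p\<close> on \<open>X\<close>, up to the condition number and the norm of \<open>B\<close>.

  For \<open>p\<close> take the polynomial whose zeros are \<open>t + 1\<close> Fekete points of \<open>X\<close> with one of them deleted:
  by maximality its modulus on \<open>X\<close> is largest at the deleted point, and the product of these maxima
  over all choices of the deleted point is the product of all mutual distances. If those products
  were infinitely often larger than the capacity allows, a weak limit of the uniform measures on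
  the Fekete points would have too large a logarithmic energy.
\<close>

unbundle no vec_syntax

section \<open>Fekete points\<close>

text \<open>Deleting a point loses nothing in the rate. With \<open>t + 1\<close> points the product
  of the maxima has \<open>(t + 1) * t\<close> factors, and the smallest maximum raised to the power
  \<open>t + 1\<close> is at most that product; a product bound \<open>exp (c * (t + 1) * t)\<close>
  thus becomes a bound \<open>exp (c * t)\<close> on the modulus, a pure \<open>t\<close>-th power
  as in the goal. What remains is one half of the Fekete-Szego theorem: the transfinite diameter is
  at most the capacity.

  The obstacle is the singularity of the logarithm. The uniform measures have atoms, so each of them
  has energy minus infinity and no bound passes to the limit directly. The kernel is therefore
  truncated from below: the diagonal then costs only the truncation level divided by the number of
  points, the weak limit is taken at a fixed level, and the level is removed afterwards by monotone
  convergence.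

  The polynomials are fixed before any matrix appears, so the error term depends on \<open>X\<close>
  alone.\<close>

lemma compact_function_box:
  fixes K :: "'i \<Rightarrow> 'a::topological_space set"
  assumes "\<And>i. compact (K i)"
  shows "compact {f. \<forall>i. f i \<in> K i}"
proof -
  have "compactin (product_topology (\<lambda>i. euclidean) UNIV) (PiE UNIV K)"
    using assms by (subst compactin_PiE) auto
  moreover have "PiE UNIV K = {f. \<forall>i. f i \<in> K i}" by auto
  ultimately show ?thesis by (simp add: euclidean_product_topology)
qed

text \<open>Taken over ordered pairs, this is the square of the Vandermonde modulus, with
  \<open>m * (m - 1)\<close> factors. The inner product at \<open>i\<close> is the modulus at
  \<open>z i\<close> of the polynomial whose zeros are the other points.\<close>

definition pair_prod :: "nat \<Rightarrow> (nat \<Rightarrow> complex) \<Rightarrow> real" where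
  "pair_prod m z = (\<Prod>i<m. \<Prod>j\<in>{..<m} - {i}. cmod (z i - z j))"

lemma continuous_on_pair_prod: "continuous_on S (pair_prod m)"
  unfolding pair_prod_def
  by (intro continuous_intros continuous_on_product_then_coordinatewise[OF continuous_on_id])

lemma pair_prod_nonneg: "pair_prod m z \<ge> 0"
  unfolding pair_prod_def by (intro prod_nonneg) auto

lemma pair_prod_pos_iff: "pair_prod m z > 0 \<longleftrightarrow> inj_on z {..<m}"
proof -
  have "pair_prod m z \<noteq> 0 \<longleftrightarrow> inj_on z {..<m}"
    unfolding pair_prod_def inj_on_def by auto
  thus ?thesis using pair_prod_nonneg[of m z] by linarith
qed

lemma fekete_points_exist:
  assumes "compact X" "X \<noteq> {}"
  obtains z where "\<And>i. i < m \<Longrightarrow> z i \<in> X"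
    "\<And>w. (\<And>i. i < m \<Longrightarrow> w i \<in> X) \<Longrightarrow> pair_prod m w \<le> pair_prod m z"
proof -
  define S where "S = {f::nat \<Rightarrow> complex. \<forall>i. f i \<in> X}"
  have "compact S" unfolding S_def by (rule compact_function_box) (use assms in auto)
  moreover have "S \<noteq> {}" unfolding S_def using assms by auto
  ultimately obtain z where z: "z \<in> S" "\<And>w. w \<in> S \<Longrightarrow> pair_prod m w \<le> pair_prod m z"
    using continuous_attains_sup[OF _ _ continuous_on_pair_prod] by metis
  show ?thesis
  proof (rule that[of z])
    show "i < m \<Longrightarrow> z i \<in> X" for i using z unfolding S_def by auto
    fix w assume w: "\<And>i. i < m \<Longrightarrow> w i \<in> X"
    obtain x where "x \<in> X" using assms by auto
    \<comment> \<open>\<open>S\<close> restricts every index, the competitor only those below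
      \<open>m\<close>; the others are sent to a point of \<open>X\<close>.\<close>
    define w' where "w' i = (if i < m then w i else x)" for i
    have "pair_prod m w = pair_prod m w'"
      unfolding pair_prod_def w'_def by (intro prod.cong) auto
    also have "\<dots> \<le> pair_prod m z" using w \<open>x \<in> X\<close> by (intro z) (auto simp: S_def w'_def)
    finally show "pair_prod m w \<le> pair_prod m z" .
  qed
qed

text \<open>The point \<open>k\<close> occurs as first and as second entry of a pair, hence the
  square. The other factor does not involve \<open>z k\<close>, so moving that point changes only
  the square.\<close>

lemma pair_prod_split:
  assumes "k < m"
  shows "pair_prod m z = (\<Prod>i\<in>{..<m}-{k}. \<Prod>j\<in>{..<m} - {i} - {k}. cmod (z i - z j))
      * (\<Prod>j\<in>{..<m}-{k}. cmod (z k - z j))\<^sup>2"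
proof -
  let ?I = "{..<m}-{k}"
  have "pair_prod m z = (\<Prod>j\<in>?I. cmod (z k - z j)) * (\<Prod>i\<in>?I. \<Prod>j\<in>{..<m} - {i}. cmod (z i - z j))"
    unfolding pair_prod_def using assms by (subst prod.remove[of _ k]) auto
  also have "(\<Prod>i\<in>?I. \<Prod>j\<in>{..<m} - {i}. cmod (z i - z j))
     = (\<Prod>i\<in>?I. cmod (z k - z i) * (\<Prod>j\<in>{..<m} - {i} - {k}. cmod (z i - z j)))"
    using assms by (intro prod.cong refl, subst prod.remove[of _ k]) (auto simp: norm_minus_commute)
  finally show ?thesis by (simp add: prod.distrib power2_eq_square mult_ac)
qed

text \<open>The minimum is at most the geometric mean, stated without roots. It selects the point to
  delete.\<close>

lemma exists_le_of_prod:
  fixes f :: "'a \<Rightarrow> real"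
  assumes "finite I" "I \<noteq> {}" "\<And>i. i \<in> I \<Longrightarrow> f i \<ge> 0"
  shows "\<exists>i\<in>I. f i ^ card I \<le> prod f I"
proof -
  define i where "i = arg_min_on f I"
  have i: "i \<in> I" "\<And>j. j \<in> I \<Longrightarrow> f i \<le> f j"
    unfolding i_def using assms arg_min_if_finite(1)[of I f] arg_min_least[of I _ f] by auto
  have "f i ^ card I = (\<Prod>j\<in>I. f i)" by simp
  also have "\<dots> \<le> prod f I" using i assms by (intro prod_mono) auto
  finally show ?thesis using i by auto
qed

lemma monic_linear_prod:
  fixes a :: "'i \<Rightarrow> complex"
  shows "degree (\<Prod>i\<in>I. [:- a i, 1:]) = card I" "lead_coeff (\<Prod>i\<in>I. [:- a i, 1:]) = 1"
proof -
  show "degree (\<Prod>i\<in>I. [:- a i, 1:]) = card I"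
    by (simp add: degree_prod_eq_sum_degree)
  show "lead_coeff (\<Prod>i\<in>I. [:- a i, 1:]) = 1"
    by (simp only: lead_coeff_prod) simp
qed

text \<open>Deleting one of the Fekete points leaves the zeros of the polynomial.\<close>

lemma small_monic_poly_of_fekete:
  assumes z: "\<And>i. i < Suc m \<Longrightarrow> z i \<in> X"
    and max: "\<And>w. (\<And>i. i < Suc m \<Longrightarrow> w i \<in> X) \<Longrightarrow> pair_prod (Suc m) w \<le> pair_prod (Suc m) z"
  obtains p :: "complex poly" where "degree p = m" "lead_coeff p = 1"
    "\<And>w. w \<in> X \<Longrightarrow> cmod (poly p w) ^ Suc m \<le> pair_prod (Suc m) z"
proof (cases "pair_prod (Suc m) z > 0")
  case True
  define g where "g k = (\<Prod>j\<in>{..<Suc m}-{k}. cmod (z k - z j))" for k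
  have "\<exists>k\<in>{..<Suc m}. g k ^ card {..<Suc m} \<le> prod g {..<Suc m}"
    by (rule exists_le_of_prod) (auto simp: g_def intro!: prod_nonneg)
  then obtain k where k: "k < Suc m" "g k ^ Suc m \<le> pair_prod (Suc m) z"
    by (auto simp: pair_prod_def g_def)
  define p where "p = (\<Prod>j\<in>{..<Suc m}-{k}. [:- z j, 1:])"
  have norm_p: "cmod (poly p w) = (\<Prod>j\<in>{..<Suc m}-{k}. cmod (w - z j))" for w
    unfolding p_def by (simp add: poly_prod prod_norm)
  show ?thesis
  proof (rule that[of p])
    show "degree p = m" unfolding p_def monic_linear_prod using k(1) by simp
    show "lead_coeff p = 1" unfolding p_def by (rule monic_linear_prod)
    fix w assume w: "w \<in> X"
    \<comment> \<open>Moving the deleted point to \<open>w\<close> cannot increase the maximal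
      product; this compares \<open>poly p w\<close> with the value \<open>g k\<close> at the old
      position.\<close>
    define z' where "z' = z(k := w)"
    define Q where "Q = (\<Prod>i\<in>{..<Suc m}-{k}. \<Prod>j\<in>{..<Suc m} - {i} - {k}. cmod (z i - z j))"
    have 1: "pair_prod (Suc m) z = Q * (g k)\<^sup>2"
      unfolding Q_def g_def by (rule pair_prod_split) fact
    have "pair_prod (Suc m) z' = Q * (cmod (poly p w))\<^sup>2"
      unfolding pair_prod_split[OF k(1)] Q_def norm_p z'_def
      by (intro arg_cong2[where f="(*)"] arg_cong[where f="\<lambda>x. x^2"] prod.cong) auto
    moreover have "pair_prod (Suc m) z' \<le> pair_prod (Suc m) z"
      using z w by (intro max) (auto simp: z'_def)
    \<comment> \<open>The common factor can be cancelled only if it is nonzero, which the case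
      distinction provides.\<close>
    moreover have "Q > 0" using True 1 unfolding Q_def
      by (smt (verit, best) mult_not_zero norm_ge_zero prod_nonneg)
    ultimately have "(cmod (poly p w))\<^sup>2 \<le> (g k)\<^sup>2" using 1 by simp
    moreover have "g k \<ge> 0" unfolding g_def by (intro prod_nonneg) auto
    ultimately have "cmod (poly p w) \<le> g k" using power2_le_imp_le by blast
    hence "cmod (poly p w) ^ Suc m \<le> g k ^ Suc m" by (intro power_mono) auto
    with k show "cmod (poly p w) ^ Suc m \<le> pair_prod (Suc m) z" by linarith
  qed
next
  case False
  \<comment> \<open>If even the maximal product vanishes, \<open>X\<close> cannot contain
    \<open>Suc m\<close> distinct points.\<close>
  have fin: "finite X \<and> card X \<le> m"
  proof (rule ccontr)
    assume "\<not> (finite X \<and> card X \<le> m)"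
    then obtain Y where Y: "Y \<subseteq> X" "finite Y" "card Y = Suc m"
      by (metis infinite_arbitrarily_large not_less_eq_eq obtain_subset_with_card_n)
    then obtain h where "bij_betw h {..<Suc m} Y"
      using ex_bij_betw_nat_finite by (metis atLeast0LessThan)
    hence "pair_prod (Suc m) h > 0" "\<And>i. i < Suc m \<Longrightarrow> h i \<in> X"
      using Y unfolding pair_prod_pos_iff by (auto simp: bij_betw_def)
    thus False using max[of h] False by force
  qed
  \<comment> \<open>Vanishes on the finite set \<open>X\<close>; the power of the variable raises
    the degree to exactly \<open>m\<close>.\<close>
  define p where "p = (\<Prod>a\<in>X. [:- a, 1:]) * monom 1 (m - card X)"
  show ?thesis
  proof (rule that[of p])
    show "lead_coeff p = 1" "degree p = m" unfolding p_def
      using fin monic_linear_prod[of "\<lambda>a. a" X] 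
      by (subst lead_coeff_mult degree_mult_eq, auto simp: degree_monom_eq)+
    fix w assume "w \<in> X"
    hence "poly p w = 0" using fin by (auto simp: p_def poly_prod prod_zero_iff)
    thus "cmod (poly p w) ^ Suc m \<le> pair_prod (Suc m) z"
      using pair_prod_nonneg[of "Suc m" z] by simp
  qed
qed

section \<open>A space-filling curve\<close>

text \<open>
  Schoenberg's formula for a space-filling curve: the piecewise linear bump is replaced by a
  clamped cosine, which has the same values on \<open>[0, 1/3]\<close> and \<open>[2/3, 1]\<close> modulo \<open>2\<close>.
\<close>

definition schoenberg_bump :: "real \<Rightarrow> real" where
  "schoenberg_bump t = max 0 (min 1 (1/2 - cos (pi * t)))"

lemma schoenberg_bump_bounds: "0 \<le> schoenberg_bump t" "schoenberg_bump t \<le> 1"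
  by (auto simp: schoenberg_bump_def)

lemma continuous_on_schoenberg_bump:
  fixes f :: "real \<Rightarrow> real"
  shows "continuous_on S f \<Longrightarrow> continuous_on S (\<lambda>x. schoenberg_bump (f x))"
  unfolding schoenberg_bump_def by (intro continuous_intros continuous_on_cos)

lemma schoenberg_bump_periodic: "schoenberg_bump (t + 2 * of_int k) = schoenberg_bump t"
proof -
  have "cos (pi * (t + 2 * of_int k)) = cos (pi * t + of_int k * (2*pi))" by (simp add: algebra_simps)
  also have "\<dots> = cos (pi * t)"
    using cos_int_2pin[of k] sin_int_2pin[of k] by (simp add: cos_add mult.commute)
  finally show ?thesis by (simp add: schoenberg_bump_def)
qed

lemma schoenberg_bump_0: assumes "0 \<le> t" "t \<le> 1/3" shows "schoenberg_bump t = 0"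
proof -
  have "cos (pi/3) \<le> cos (pi * t)"
    using assms by (intro cos_monotone_0_pi_le) (auto simp: field_simps)
  thus ?thesis by (simp add: schoenberg_bump_def cos_60)
qed

lemma schoenberg_bump_1: assumes "2/3 \<le> t" "t \<le> 1" shows "schoenberg_bump t = 1"
proof -
  have "cos (pi * t) \<le> cos (2/3 * pi)"
    using assms by (intro cos_monotone_0_pi_le) (auto simp: field_simps)
  also have "\<dots> = - 1/2" using cos_120 by simp
  finally show ?thesis by (simp add: schoenberg_bump_def)
qed

text \<open>Each digit is the parity of a floor, so the first \<open>n\<close> terms add up to the
  floor of \<open>2 ^ n * x\<close> divided by \<open>2 ^ n\<close>. The induction starts at 0
  because the floor of \<open>x\<close> is 0.\<close>

lemma binary_expansion:
  fixes x :: real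
  assumes "0 \<le> x" "x < 1"
  obtains a :: "nat \<Rightarrow> bool" where "(\<lambda>k. of_bool (a k) / 2 ^ Suc k) sums x"
proof -
  define a where "a k = odd \<lfloor>2 ^ Suc k * x\<rfloor>" for k
  have step: "\<lfloor>2 * y\<rfloor> = 2 * \<lfloor>y\<rfloor> + of_bool (odd \<lfloor>2 * y\<rfloor>)" for y :: real
  proof -
    have "\<lfloor>2 * y\<rfloor> = 2 * \<lfloor>y\<rfloor> \<or> \<lfloor>2 * y\<rfloor> = 2 * \<lfloor>y\<rfloor> + 1" by linarith
    thus ?thesis by auto
  qed
  have part: "(\<Sum>k<n. of_bool (a k) / 2 ^ Suc k :: real) = of_int \<lfloor>2 ^ n * x\<rfloor> / 2 ^ n" for n
  proof (induction n)
    case 0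
    then show ?case using assms floor_eq_iff[of x 0] by simp
  next
    case (Suc n)
    have "\<lfloor>2 ^ Suc n * x\<rfloor> = 2 * \<lfloor>2 ^ n * x\<rfloor> + of_bool (a n)"
      unfolding a_def using step[of "2 ^ n * x"] by (simp add: mult.assoc)
    hence "real_of_int \<lfloor>2 ^ Suc n * x\<rfloor> = 2 * of_int \<lfloor>2 ^ n * x\<rfloor> + of_bool (a n)"
      by simp
    then show ?case using Suc by (simp add: field_simps)
  qed
  have "(\<lambda>n. of_int \<lfloor>2 ^ n * x\<rfloor> / 2 ^ n) \<longlonglongrightarrow> x"
  proof (rule tendsto_sandwich[of "\<lambda>n. x - (1/2)^n" _ _ "\<lambda>n. x"])
    show "(\<lambda>n. x - (1/2)^n) \<longlonglongrightarrow> x"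
      by (rule tendsto_eq_intros LIMSEQ_power_zero | simp)+
    show "\<forall>\<^sub>F n in sequentially. x - (1/2)^n \<le> of_int \<lfloor>2 ^ n * x\<rfloor> / 2 ^ n"
    proof (rule always_eventually, rule)
      fix n
      have "2 ^ n * x - 1 \<le> of_int \<lfloor>2 ^ n * x\<rfloor>" by linarith
      hence "(2 ^ n * x - 1) / 2 ^ n \<le> of_int \<lfloor>2 ^ n * x\<rfloor> / 2 ^ n"
        by (rule divide_right_mono) simp
      moreover have "(2 ^ n * x - 1) / 2 ^ n = x - (1/2)^n"
        by (simp add: diff_divide_distrib power_divide)
      ultimately show "x - (1/2)^n \<le> of_int \<lfloor>2 ^ n * x\<rfloor> / 2 ^ n" by simp
    qed
    show "\<forall>\<^sub>F n in sequentially. of_int \<lfloor>2 ^ n * x\<rfloor> / 2 ^ n \<le> x"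
      by (rule always_eventually) (auto simp: divide_simps mult.commute)
  qed simp
  hence "(\<lambda>k. of_bool (a k) / 2 ^ Suc k) sums x"
    unfolding sums_def part .
  thus ?thesis by (rule that)
qed

text \<open>
  The witness is the point of the Cantor set with ternary digits \<open>2 * a k\<close>; multiplication by
  \<open>3 ^ k\<close> shifts these digits up to an even integer.
\<close>

lemma ternary_point:
  fixes a :: "nat \<Rightarrow> bool"
  obtains t where "0 \<le> t" "t \<le> 1" "\<And>k. schoenberg_bump (3 ^ k * t) = of_bool (a k)"
proof -
  define T where "T k = (\<Sum>i. 2 * of_bool (a (i + k)) / 3 ^ Suc i :: real)" for k :: nat
  have geo: "(\<lambda>i. 2 / 3 ^ Suc i :: real) sums 1"
    using sums_mult[OF geometric_sums[of "1/3::real"], of "2/3"] by (simp add: power_divide)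
  have summ: "summable (\<lambda>i. 2 * of_bool (a (i + k)) / 3 ^ Suc i :: real)" for k
    by (rule summable_comparison_test'[OF sums_summable[OF geo], of 0]) (auto simp: of_bool_def)
  have T: "0 \<le> T k" "T k \<le> 1" for k
  proof -
    show "0 \<le> T k" unfolding T_def by (rule suminf_nonneg[OF summ]) auto
    have "T k \<le> (\<Sum>i. 2 / 3 ^ Suc i)" unfolding T_def
      by (rule suminf_le[OF _ summ sums_summable[OF geo]]) (auto simp: of_bool_def)
    thus "T k \<le> 1" using sums_unique[OF geo] by simp
  qed
  have rec: "3 * T k = 2 * of_bool (a k) + T (Suc k)" for k
  proof -
    have "T k = (\<Sum>i. 2 * of_bool (a (Suc i + k)) / 3 ^ Suc (Suc i)) + 2 * of_bool (a k) / 3"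
      unfolding T_def using suminf_split_head[OF summ[of k]] by simp
    also have "(\<Sum>i. 2 * of_bool (a (Suc i + k)) / 3 ^ Suc (Suc i)) = T (Suc k) / 3"
      unfolding T_def by (subst suminf_divide[OF summ, symmetric]) (simp add: mult.commute)
    finally show ?thesis by (simp add: field_simps)
  qed
  have "\<exists>j::int. 3 ^ k * T 0 = T k + 2 * of_int j" for k
  proof (induction k)
    case (Suc k)
    then obtain j where "3 ^ k * T 0 = T k + 2 * of_int j" by auto
    hence "3 ^ Suc k * T 0 = T (Suc k) + 2 * of_int (of_bool (a k) + 3 * j)"
      using rec[of k] by simp
    thus ?case by blast
  qed (auto intro: exI[of _ 0])
  \<comment> \<open>By \<open>rec\<close>, \<open>T k\<close> lies in [2/3, 1] or in [0, 1/3]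
    according to \<open>a k\<close>, and the bump is constant on each of these intervals.\<close>
  moreover have "schoenberg_bump (T k) = of_bool (a k)" for k
    using rec[of k] T[of "Suc k"]
    by (cases "a k") (auto intro!: schoenberg_bump_0 schoenberg_bump_1)
  ultimately have "schoenberg_bump (3 ^ k * T 0) = of_bool (a k)" for k
    by (metis schoenberg_bump_periodic)
  with T show ?thesis by (intro that[of "T 0"])
qed

text \<open>On the Cantor set this reads the ternary digits with index of parity \<open>e\<close>,
  halved, as binary digits; the values 0 and 1 of \<open>e\<close> give the two coordinates of the
  curve.\<close>

definition schoenberg_coord :: "nat \<Rightarrow> real \<Rightarrow> real" where
  "schoenberg_coord e t = (\<Sum>k. schoenberg_bump (3 ^ (2 * k + e) * t) / 2 ^ Suc k)"

lemma continuous_on_schoenberg_coord: "continuous_on UNIV (schoenberg_coord e)"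
  unfolding schoenberg_coord_def
proof (rule uniform_limit_theorem)
  have "summable (\<lambda>k. 1 / 2 ^ Suc k :: real)"
    using summable_mult[OF summable_geometric[of "1/2::real"], of "1/2"] by (simp add: power_divide)
  thus "uniform_limit UNIV (\<lambda>n t. \<Sum>k<n. schoenberg_bump (3 ^ (2 * k + e) * t) / 2 ^ Suc k)
     (\<lambda>t. \<Sum>k. schoenberg_bump (3 ^ (2 * k + e) * t) / 2 ^ Suc k) sequentially"
    by (intro Weierstrass_m_test) (auto simp: divide_right_mono schoenberg_bump_bounds)
  show "\<forall>\<^sub>F n in sequentially. continuous_on UNIV
      (\<lambda>t. \<Sum>k<n. schoenberg_bump (3 ^ (2 * k + e) * t) / 2 ^ Suc k)"
    by (intro always_eventually allI continuous_intros continuous_on_schoenberg_bump) auto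
qed simp

lemma schoenberg_surj:
  assumes "0 \<le> x" "x < 1" "0 \<le> y" "y < 1"
  obtains t where "0 \<le> t" "t \<le> 1" "schoenberg_coord 0 t = x" "schoenberg_coord 1 t = y"
proof -
  obtain a where a: "(\<lambda>k. of_bool (a k) / 2 ^ Suc k) sums x" using binary_expansion assms by blast
  obtain b where b: "(\<lambda>k. of_bool (b k) / 2 ^ Suc k) sums y" using binary_expansion assms by blast
  \<comment> \<open>The digits of the two coordinates are interleaved.\<close>
  obtain t where t: "0 \<le> t" "t \<le> 1"
    "\<And>k. schoenberg_bump (3 ^ k * t) = of_bool (if even k then a (k div 2) else b (k div 2))"
    by (rule ternary_point[of "\<lambda>k. if even k then a (k div 2) else b (k div 2)"]) (rule that)
  show ?thesis
  proof (rule that[OF t(1,2)])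
    show "schoenberg_coord 0 t = x" "schoenberg_coord 1 t = y"
      unfolding schoenberg_coord_def t(3) using sums_unique[OF a] sums_unique[OF b]
      by simp_all
  qed
qed

lemma bounded_subset_curve:
  fixes X :: "complex set"
  assumes "bounded X"
  obtains h :: "real \<Rightarrow> complex" where "continuous_on UNIV h" "X \<subseteq> h ` {0..1}"
proof -
  \<comment> \<open>The bound is strict since \<open>schoenberg_surj\<close> reaches the half-open
    unit square.\<close>
  obtain R where R: "R > 0" "\<And>z. z \<in> X \<Longrightarrow> cmod z < R"
    using assms by (meson bounded_pos_less)
  define h where "h t = Complex (2 * R * schoenberg_coord 0 t - R) (2 * R * schoenberg_coord 1 t - R)" for t
  show ?thesis
  proof (rule that[of h])
    show "continuous_on UNIV h" unfolding h_def
      by (intro continuous_on_Complex continuous_intros continuous_on_schoenberg_coord)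
    show "X \<subseteq> h ` {0..1}"
    proof
      fix z assume "z \<in> X"
      hence "\<bar>Re z\<bar> < R" "\<bar>Im z\<bar> < R"
        using R(2) abs_Re_le_cmod abs_Im_le_cmod by (meson le_less_trans)+
      hence "0 \<le> (Re z + R) / (2 * R)" "(Re z + R) / (2 * R) < 1"
        "0 \<le> (Im z + R) / (2 * R)" "(Im z + R) / (2 * R) < 1"
        using R(1) by (auto simp: field_simps)
      then obtain t where t: "0 \<le> t" "t \<le> 1"
        "schoenberg_coord 0 t = (Re z + R) / (2 * R)" "schoenberg_coord 1 t = (Im z + R) / (2 * R)"
        by (rule schoenberg_surj) (rule that)
      hence "h t = z" using R(1) by (simp add: h_def complex_eq_iff)
      thus "z \<in> h ` {0..1}" using t by force
    qed
  qed
qed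

section \<open>Logarithmic energy of weak limits\<close>

text \<open>
  Weak compactness for measures on a plane compactum is pulled back along the curve to Helly's
  selection theorem on the line.
\<close>

lemma skorohod_subsequence_uniform:
  fixes X :: "complex set" and z :: "nat \<Rightarrow> nat \<Rightarrow> complex" and m :: "nat \<Rightarrow> nat"
  assumes X: "compact X" and m: "\<And>N. m N > 0" and z: "\<And>N i. z N i \<in> X"
  obtains \<Omega> :: "real measure" and Y :: "nat \<Rightarrow> real \<Rightarrow> complex" and Y' :: "real \<Rightarrow> complex" and r :: "nat \<Rightarrow> nat"
  where "prob_space \<Omega>" "strict_mono r" "\<And>n. Y n \<in> borel_measurable \<Omega>" "Y' \<in> borel_measurable \<Omega>"
    "\<And>n. distr \<Omega> borel (Y n) = distr (pmf_of_set {..<m (r n)}) borel (z (r n))"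
    "\<And>x. x \<in> space \<Omega> \<Longrightarrow> (\<lambda>n. Y n x) \<longlonglongrightarrow> Y' x"
    "AE x in \<Omega>. Y' x \<in> X"
proof -
  obtain h :: "real \<Rightarrow> complex" where h: "continuous_on UNIV h" "X \<subseteq> h ` {0..1}"
    by (rule bounded_subset_curve[OF compact_imp_bounded[OF X]]) (rule that)
  have [measurable]: "h \<in> borel_measurable borel" 
    using h(1) by (rule borel_measurable_continuous_onI)
  \<comment> \<open>Any preimages under \<open>h\<close> will do: on the discrete measures
    \<open>P N\<close> every function is measurable.\<close>
  have "\<exists>t\<in>{0..1}. h t = z N i" for N i using h(2) z[of N i] by force
  then obtain u where u: "\<And>N i. u N i \<in> {0..1}" "\<And>N i. h (u N i) = z N i" by metis
  define P where "P N = measure_pmf (pmf_of_set {..<m N})" for N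
  define \<nu> where "\<nu> N = distr (P N) borel (u N)" for N
  have [measurable]: "f \<in> P N \<rightarrow>\<^sub>M borel" for f :: "nat \<Rightarrow> 'b::topological_space" and N
    by (simp add: P_def)
  have rd: "real_distribution (\<nu> N)" for N
    unfolding \<nu>_def P_def by (intro prob_space.real_distribution_distr measure_pmf.prob_space_axioms) simp
  have tight: "tight \<nu>"
    unfolding tight_def
  proof (intro conjI allI impI rd)
    fix e :: real assume "e > 0"
    \<comment> \<open>Tightness is phrased with half-open intervals, so the left end has to lie
      below 0.\<close>
    have "measure (\<nu> N) {-1<..1} = 1" for N
    proof -
      have "u N -` {-1<..1} = UNIV" using u(1)[of N] by force
      thus ?thesis unfolding \<nu>_def P_def by (subst measure_distr) auto
    qed
    thus "\<exists>a b. a < b \<and> (\<forall>n. measure (\<nu> n) {a<..b} > 1 - e)"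
      using \<open>e > 0\<close> by (intro exI[of _ "-1"] exI[of _ 1]) auto
  qed
  obtain r M where r: "strict_mono (r :: nat \<Rightarrow> nat)" "real_distribution M" "weak_conv_m (\<nu> \<circ> id \<circ> r) M"
    using tight_imp_convergent_subsubsequence[OF tight strict_mono_id] by blast
  \<comment> \<open>Skorohod's representation turns weak convergence into pointwise convergence,
    which the continuous \<open>h\<close> carries over to the plane.\<close>
  have "\<exists>(\<Omega>::real measure) (T::nat \<Rightarrow> real \<Rightarrow> real) (T'::real \<Rightarrow> real). prob_space \<Omega> \<and>
      (\<forall>n. T n \<in> measurable \<Omega> borel) \<and> (\<forall>n. distr \<Omega> borel (T n) = (\<nu> \<circ> id \<circ> r) n) \<and>
      T' \<in> measurable \<Omega> lborel \<and> distr \<Omega> borel T' = M \<and>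
      (\<forall>x \<in> space \<Omega>. (\<lambda>n. T n x) \<longlonglongrightarrow> T' x)"
    by (rule Skorohod) (use rd r in \<open>auto simp: comp_def\<close>)
  then obtain \<Omega> :: "real measure" and T :: "nat \<Rightarrow> real \<Rightarrow> real" and T' :: "real \<Rightarrow> real" where
    \<Omega>: "prob_space \<Omega>" "\<forall>n. T n \<in> measurable \<Omega> borel" "\<forall>n. distr \<Omega> borel (T n) = (\<nu> \<circ> id \<circ> r) n"
      "T' \<in> measurable \<Omega> lborel" "\<forall>x \<in> space \<Omega>. (\<lambda>n. T n x) \<longlonglongrightarrow> T' x"
    by (elim exE conjE)
  have [measurable]: "T n \<in> borel_measurable \<Omega>" for n using \<Omega>(2) by simp
  have [measurable]: "T' \<in> borel_measurable \<Omega>" using \<Omega>(4) by simp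
  have Xb[measurable]: "X \<in> sets borel" using X by (simp add: compact_imp_closed)
  have dist: "distr \<Omega> borel (\<lambda>x. h (T n x)) = distr (P (r n)) borel (z (r n))" for n
  proof -
    have "distr \<Omega> borel (\<lambda>x. h (T n x)) = distr (distr \<Omega> borel (T n)) borel h"
      by (subst distr_distr) (auto simp: comp_def)
    also have "\<dots> = distr (P (r n)) borel (z (r n))"
      using \<Omega>(3) by (simp add: \<nu>_def distr_distr comp_def u)
    finally show ?thesis .
  qed
  have lim: "(\<lambda>n. h (T n x)) \<longlonglongrightarrow> h (T' x)" if "x \<in> space \<Omega>" for x
    using h(1) \<Omega>(5) that by (auto simp: continuous_on_def intro: tendsto_compose)
  have "AE x in \<Omega>. h (T n x) \<in> X" for n
  proof -
    have "AE w in distr \<Omega> borel (\<lambda>x. h (T n x)). w \<in> X"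
      unfolding dist by (subst AE_distr_iff) (auto simp: z)
    thus ?thesis by (subst (asm) AE_distr_iff) auto
  qed
  hence "AE x in \<Omega>. \<forall>n. h (T n x) \<in> X" by (simp add: AE_all_countable)
  hence "AE x in \<Omega>. h (T' x) \<in> X"
  proof (rule AE_mp, intro AE_I2 impI)
    fix x assume "x \<in> space \<Omega>" "\<forall>n. h (T n x) \<in> X"
    thus "h (T' x) \<in> X"
      using closed_sequentially[OF compact_imp_closed[OF X] _ lim] by blast
  qed
  with \<Omega>(1) r(1) lim dist show ?thesis
    unfolding P_def by (intro that[of \<Omega> r "\<lambda>n x. h (T n x)" "\<lambda>x. h (T' x)"]) auto
qed

text \<open>
  Logarithmic kernel cut off from below at \<open>- M\<close>; the cut-off at \<open>L\<close> is invisible on sets of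
  diameter at most \<open>exp L\<close> and only serves to make the kernel bounded everywhere.
\<close>

definition trunc_log :: "real \<Rightarrow> real \<Rightarrow> complex \<Rightarrow> complex \<Rightarrow> real" where
  "trunc_log M L z w = ln (max (exp (- M)) (min (exp L) (cmod (z - w))))"

lemma trunc_log_bounds:
  assumes "M \<ge> 0" "L \<ge> 0"
  shows "- M \<le> trunc_log M L z w" "trunc_log M L z w \<le> L"
proof -
  have pos: "max (exp (- M)) (min (exp L) (cmod (z - w))) > 0"
    by (simp add: less_max_iff_disj)
  show "- M \<le> trunc_log M L z w" unfolding trunc_log_def using pos by (simp add: ln_ge_iff)
  have "max (exp (- M)) (min (exp L) (cmod (z - w))) \<le> exp L"
    using assms by (simp add: order_trans[of _ 0])
  hence "ln (max (exp (- M)) (min (exp L) (cmod (z - w)))) \<le> ln (exp L)"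
    using pos by (subst ln_le_cancel_iff) auto
  thus "trunc_log M L z w \<le> L" unfolding trunc_log_def by simp
qed

lemma abs_trunc_log_le: "M \<ge> 0 \<Longrightarrow> L \<ge> 0 \<Longrightarrow> \<bar>trunc_log M L z w\<bar> \<le> M + L"
  using trunc_log_bounds[of M L z w] by linarith

lemma tendsto_trunc_log:
  "((\<lambda>n. f n) \<longlongrightarrow> a) F \<Longrightarrow> (g \<longlongrightarrow> b) F \<Longrightarrow> ((\<lambda>n. trunc_log M L (f n) (g n)) \<longlongrightarrow> trunc_log M L a b) F"
  unfolding trunc_log_def by (intro tendsto_intros) (auto simp: max_def min_def dest: order_antisym[OF _ exp_ge_zero])

lemma trunc_log_measurable [measurable]:
  assumes [measurable]: "f \<in> borel_measurable M'" "g \<in> borel_measurable M'"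
  shows "(\<lambda>x. trunc_log M L (f x) (g x)) \<in> borel_measurable M'"
  unfolding trunc_log_def by measurable

text \<open>Dominated convergence, for the inner and then for the outer integral, with the constant
  bound \<open>K + L\<close>. In the iterated integral one map \<open>Y n\<close> supplies both
  coordinates, which amounts to integrating over the product of its law with itself.\<close>

lemma (in prob_space) integral_trunc_log_tendsto:
  assumes [measurable]: "\<And>n. Y n \<in> borel_measurable M" "Y' \<in> borel_measurable M"
    and lim: "\<And>x. x \<in> space M \<Longrightarrow> (\<lambda>n. Y n x) \<longlonglongrightarrow> Y' x"
    and KL: "K \<ge> 0" "L \<ge> 0"
  shows "(\<lambda>n. \<integral>x. \<integral>y. trunc_log K L (Y n x) (Y n y) \<partial>M \<partial>M)
     \<longlonglongrightarrow> (\<integral>x. \<integral>y. trunc_log K L (Y' x) (Y' y) \<partial>M \<partial>M)"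
proof (rule integral_dominated_convergence[where w = "\<lambda>_. K + L"])
  show "AE x in M. (\<lambda>n. \<integral>y. trunc_log K L (Y n x) (Y n y) \<partial>M) \<longlonglongrightarrow> (\<integral>y. trunc_log K L (Y' x) (Y' y) \<partial>M)"
  proof (rule AE_I2)
    fix x assume x: "x \<in> space M"
    show "(\<lambda>n. \<integral>y. trunc_log K L (Y n x) (Y n y) \<partial>M) \<longlonglongrightarrow> (\<integral>y. trunc_log K L (Y' x) (Y' y) \<partial>M)"
      by (rule integral_dominated_convergence[where w = "\<lambda>_. K + L"])
         (use x KL in \<open>auto intro!: AE_I2 tendsto_trunc_log lim abs_trunc_log_le\<close>)
  qed
  show "AE x in M. norm (\<integral>y. trunc_log K L (Y n x) (Y n y) \<partial>M) \<le> K + L" for n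
  proof (rule AE_I2)
    fix x
    have int: "integrable M (\<lambda>y. trunc_log K L (Y n x) (Y n y))"
      by (rule integrable_const_bound[where B="K+L"]) (use KL in \<open>auto intro!: abs_trunc_log_le\<close>)
    have "(\<integral>y. trunc_log K L (Y n x) (Y n y) \<partial>M) \<le> K + L" "- (K + L) \<le> (\<integral>y. trunc_log K L (Y n x) (Y n y) \<partial>M)"
      using abs_trunc_log_le[OF KL]
      by (intro integral_le_const integral_ge_const int AE_I2; smt (verit))+
    thus "norm (\<integral>y. trunc_log K L (Y n x) (Y n y) \<partial>M) \<le> K + L" by simp
  qed
qed auto

lemma (in prob_space) integral_uniform_trunc_log:
  assumes Y[measurable]: "Y \<in> borel_measurable M"
    and distr: "distr M borel Y = distr (pmf_of_set {..<m}) borel z" and m: "m > 0"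
    and KL: "K \<ge> 0" "L \<ge> 0"
  shows "(\<integral>x. \<integral>y. trunc_log K L (Y x) (Y y) \<partial>M \<partial>M)
    = (\<Sum>i<m. \<Sum>j<m. trunc_log K L (z i) (z j)) / real m ^ 2"
proof -
  have *: "(\<integral>x. g (Y x) \<partial>M) = (\<Sum>i<m. g (z i)) / real m" if [measurable]: "g \<in> borel_measurable borel" for g :: "complex \<Rightarrow> real"
  proof -
    have "(\<integral>x. g (Y x) \<partial>M) = (\<integral>w. g w \<partial>distr M borel Y)"
      by (subst integral_distr) auto
    also have "\<dots> = (\<integral>i. g (z i) \<partial>pmf_of_set {..<m})" unfolding distr by (subst integral_distr) auto
    also have "\<dots> = (\<Sum>i<m. g (z i)) / real m" using m by (subst integral_pmf_of_set) auto
    finally show ?thesis .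
  qed
  have "(\<integral>x. \<integral>y. trunc_log K L (Y x) (Y y) \<partial>M \<partial>M) = (\<integral>x. (\<Sum>j<m. trunc_log K L (Y x) (z j)) / real m \<partial>M)"
    by (subst *) auto
  also have "\<dots> = (\<Sum>i<m. (\<Sum>j<m. trunc_log K L (z i) (z j)) / real m) / real m"
    by (subst *[of "\<lambda>w. (\<Sum>j<m. trunc_log K L w (z j)) / real m"]) auto
  finally show ?thesis by (simp add: sum_divide_distrib power2_eq_square)
qed

text \<open>Off the diagonal, truncation can only raise the logarithm; each of the \<open>m\<close>
  diagonal terms equals \<open>- K\<close>. After division by \<open>m ^ 2\<close>, having
  \<open>m * (m - 1)\<close> instead of \<open>m ^ 2\<close> pairs costs \<open>c / m\<close>, and
  the diagonal terms cost \<open>K / m\<close>.\<close>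

lemma sum_trunc_log_ge:
  assumes P: "pair_prod m z \<ge> exp (c * (real m * (real m - 1)))" and m: "m > 0"
    and L: "\<And>i j. i < m \<Longrightarrow> j < m \<Longrightarrow> cmod (z i - z j) \<le> exp L" and KL: "K \<ge> 0" "L \<ge> 0"
  shows "(\<Sum>i<m. \<Sum>j<m. trunc_log K L (z i) (z j)) / real m ^ 2 \<ge> c - (c + K) / real m"
proof -
  have "pair_prod m z > 0" using P exp_gt_zero less_le_trans by blast
  hence inj: "inj_on z {..<m}" by (simp add: pair_prod_pos_iff)
  have ne: "z i \<noteq> z j" if "i < m" "j \<in> {..<m} - {i}" for i j
    using inj that by (auto simp: inj_on_def)
  have "c * (real m * (real m - 1)) \<le> ln (pair_prod m z)"
    using P \<open>pair_prod m z > 0\<close> by (simp add: ln_ge_iff)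
  also have "ln (pair_prod m z) = (\<Sum>i<m. \<Sum>j\<in>{..<m} - {i}. ln (cmod (z i - z j)))"
  proof -
    have "ln (pair_prod m z) = (\<Sum>i<m. ln (\<Prod>j\<in>{..<m} - {i}. cmod (z i - z j)))"
      unfolding pair_prod_def using ne by (intro ln_prod) (auto intro!: prod_pos)
    also have "\<dots> = (\<Sum>i<m. \<Sum>j\<in>{..<m} - {i}. ln (cmod (z i - z j)))"
      using ne by (intro sum.cong refl ln_prod) auto
    finally show ?thesis .
  qed
  also have "\<dots> \<le> (\<Sum>i<m. (\<Sum>j<m. trunc_log K L (z i) (z j)) + K)"
  proof (rule sum_mono)
    fix i assume i: "i \<in> {..<m}"
    have "(\<Sum>j\<in>{..<m} - {i}. ln (cmod (z i - z j))) \<le> (\<Sum>j\<in>{..<m} - {i}. trunc_log K L (z i) (z j))"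
    proof (rule sum_mono)
      fix j assume j: "j \<in> {..<m} - {i}"
      have "cmod (z i - z j) > 0" "cmod (z i - z j) \<le> exp L" using ne[of i j] i j L[of i j] by auto
      thus "ln (cmod (z i - z j)) \<le> trunc_log K L (z i) (z j)"
        unfolding trunc_log_def by (subst ln_le_cancel_iff) (auto simp: less_max_iff_disj)
    qed
    also have "\<dots> = (\<Sum>j<m. trunc_log K L (z i) (z j)) - trunc_log K L (z i) (z i)"
      using i by (simp add: sum_diff1)
    also have "trunc_log K L (z i) (z i) = - K" by (simp add: trunc_log_def min_def max_def)
    finally show "(\<Sum>j\<in>{..<m} - {i}. ln (cmod (z i - z j))) \<le> (\<Sum>j<m. trunc_log K L (z i) (z j)) + K" by simp
  qed
  also have "\<dots> = (\<Sum>i<m. \<Sum>j<m. trunc_log K L (z i) (z j)) + real m * K"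
    by (simp add: sum.distrib)
  finally have "c * (real m * (real m - 1)) - real m * K \<le> (\<Sum>i<m. \<Sum>j<m. trunc_log K L (z i) (z j))" by simp
  hence "(c * (real m * (real m - 1)) - real m * K) / real m ^ 2 \<le> (\<Sum>i<m. \<Sum>j<m. trunc_log K L (z i) (z j)) / real m ^ 2"
    by (rule divide_right_mono) simp
  also have "(c * (real m * (real m - 1)) - real m * K) / real m ^ 2 = c - (c + K) / real m"
    using m by (simp add: field_simps power2_eq_square)
  finally show ?thesis .
qed

section \<open>Bounds for the logarithmic energy\<close>

lemma AE_pair_prob_measures_on:
  assumes \<mu>: "\<mu> \<in> prob_measures_on X" and X[measurable]: "X \<in> sets borel"
  shows "AE p in \<mu> \<Otimes>\<^sub>M \<mu>. fst p \<in> X \<and> snd p \<in> X"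
proof -
  have [measurable_cong]: "sets \<mu> = sets borel" and "prob_space \<mu>" and null: "emeasure \<mu> (UNIV - X) = 0"
    using \<mu> by (auto simp: prob_measures_on_def)
  interpret \<mu>: prob_space \<mu> by fact
  interpret pair: pair_prob_space \<mu> \<mu> ..
  have "AE x in \<mu>. x \<in> X"
    using null by (intro AE_I[of _ _ "UNIV - X"]) auto
  thus ?thesis
    by (intro pair.AE_pair_measure) (auto elim: eventually_mono)
qed

lemma max_0_ln_le:
  fixes x L :: real
  assumes "L \<ge> 0" "0 \<le> x" "x \<le> exp L"
  shows "max 0 (ln x) \<le> L"
proof (cases "x = 0")
  case False
  hence "ln x \<le> ln (exp L)" using assms by (subst ln_le_cancel_iff) auto
  thus ?thesis using assms by simp
qed (use assms in simp)

text \<open>Keeps the supremum away from plus infinity, where \<open>real_of_ereal\<close> would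
  return 0 and the capacity would be 1.\<close>

lemma log_energy_sup_le:
  assumes X: "X \<in> sets borel"
    and L: "L \<ge> 0" "\<And>z w. z \<in> X \<Longrightarrow> w \<in> X \<Longrightarrow> cmod (z - w) \<le> exp L"
  shows "log_energy_sup X \<le> ereal L"
  unfolding log_energy_sup_def
proof (rule SUP_least)
  fix \<mu> assume \<mu>: "\<mu> \<in> prob_measures_on X"
  hence "prob_space \<mu>" by (simp add: prob_measures_on_def)
  then interpret \<mu>: prob_space \<mu> .
  interpret pair: pair_prob_space \<mu> \<mu> ..
  have "(\<integral>\<^sup>+ p. ennreal (max 0 (ln (cmod (fst p - snd p)))) \<partial>(\<mu> \<Otimes>\<^sub>M \<mu>)) \<le> (\<integral>\<^sup>+ p. ennreal L \<partial>(\<mu> \<Otimes>\<^sub>M \<mu>))"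
  proof (rule nn_integral_mono_AE)
    show "AE p in \<mu> \<Otimes>\<^sub>M \<mu>. ennreal (max 0 (ln (cmod (fst p - snd p)))) \<le> ennreal L"
      using AE_pair_prob_measures_on[OF \<mu> X]
    proof eventually_elim
      case (elim p)
      thus ?case by (intro ennreal_leI max_0_ln_le L) auto
    qed
  qed
  also have "\<dots> = ennreal L" by (simp add: pair.P.emeasure_space_1)
  finally have "enn2ereal (\<integral>\<^sup>+ p. ennreal (max 0 (ln (cmod (fst p - snd p)))) \<partial>(\<mu> \<Otimes>\<^sub>M \<mu>)) \<le> ereal L"
    using L(1) by (simp add: less_eq_ennreal.rep_eq enn2ereal_ennreal)
  thus "log_energy \<mu> \<le> ereal L"
    unfolding log_energy_def by (meson ereal_diff_le_self enn2ereal_nonneg order_trans)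
qed

text \<open>The negative parts \<open>g K\<close> of the truncated kernels increase with
  \<open>K\<close> to the negative part of the logarithm. Their integrals are at most the integral
  of the positive part minus \<open>c\<close>, uniformly in \<open>K\<close>, so monotone
  convergence applies.\<close>

lemma log_energy_ge:
  assumes \<mu>: "\<mu> \<in> prob_measures_on X" and X: "X \<in> sets borel"
    and L: "L \<ge> 0" "\<And>z w. z \<in> X \<Longrightarrow> w \<in> X \<Longrightarrow> cmod (z - w) \<le> exp L"
    and ge: "\<And>K::nat. (\<integral>x. \<integral>y. trunc_log K L x y \<partial>\<mu> \<partial>\<mu>) \<ge> c"
  shows "log_energy \<mu> \<ge> ereal c"
proof -
  have [measurable_cong]: "sets \<mu> = sets borel" and "prob_space \<mu>" and null: "emeasure \<mu> (UNIV - X) = 0"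
    using \<mu> by (auto simp: prob_measures_on_def)
  interpret \<mu>: prob_space \<mu> by fact
  interpret pair: pair_prob_space \<mu> \<mu> ..
  let ?P = "\<mu> \<Otimes>\<^sub>M \<mu>"
  note AEX = AE_pair_prob_measures_on[OF \<mu> X]
  define d where "d p = cmod (fst p - snd p)" for p :: "complex \<times> complex"
  have [measurable]: "d \<in> borel_measurable ?P" unfolding d_def by measurable
  define fp where "fp p = max 0 (ln (d p))" for p
  have [measurable]: "fp \<in> borel_measurable ?P" unfolding fp_def by measurable
  define g where "g K p = max 0 (- trunc_log (real K) L (fst p) (snd p))" for K :: nat and p
  have [measurable]: "g K \<in> borel_measurable ?P" for K unfolding g_def by measurable
  have fpL: "AE p in ?P. norm (fp p) \<le> L"
    using AEX
  proof eventually_elim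
    case (elim p)
    thus ?case using max_0_ln_le[OF L(1), of "d p"] L(2) by (simp add: fp_def d_def)
  qed
  have int_fp: "integrable ?P fp" by (rule pair.P.integrable_const_bound[OF fpL]) measurable
  have int_k: "integrable ?P (\<lambda>p. trunc_log (real K) L (fst p) (snd p))" for K :: nat
    by (rule pair.P.integrable_const_bound[where B="real K + L"]) (use L abs_trunc_log_le in auto)
  have int_g: "integrable ?P (g K)" for K
  proof (rule pair.P.integrable_const_bound[where B="real K + L"])
    have "norm (g K p) \<le> real K + L" for p
      using L(1) trunc_log_bounds[of "real K" L "fst p" "snd p"] by (simp add: g_def)
    thus "AE p in ?P. norm (g K p) \<le> real K + L" by simp
  qed measurable
  \<comment> \<open>The truncated kernel has the positive part \<open>fp\<close> for every
    \<open>K\<close>. The identity is used on \<open>X \<times> X\<close>, where the cut-off at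
    \<open>L\<close> is inactive.\<close>
  have eq: "AE p in ?P. g K p = fp p - trunc_log (real K) L (fst p) (snd p)" for K
    using AEX
  proof eventually_elim
    case (elim p)
    have m: "min (exp L) (d p) = d p" using L(2) elim by (auto simp: d_def)
    have k: "trunc_log (real K) L (fst p) (snd p) = ln (max (exp (- real K)) (d p))"
      unfolding trunc_log_def m[unfolded d_def] d_def ..
    show ?case
    proof (cases "d p > exp (- real K)")
      case True
      thus ?thesis by (auto simp: g_def k fp_def max_def)
    next
      case False
      \<comment> \<open>The diagonal is included, by the convention \<open>ln 0 = 0\<close>.\<close>
      have "ln (d p) \<le> 0"
      proof (cases "d p = 0")
        case False
        hence "d p > 0" by (simp add: d_def)
        moreover have "d p \<le> 1" using \<open>\<not> d p > exp (- real K)\<close>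
          by (smt (verit) exp_le_one_iff of_nat_0_le_iff)
        ultimately show ?thesis by simp
      qed simp
      with False show ?thesis by (auto simp: g_def k fp_def max_def)
    qed
  qed
  have int_g_le: "(\<integral>p. g K p \<partial>?P) \<le> (\<integral>p. fp p \<partial>?P) - c" for K
  proof -
    have "(\<integral>p. g K p \<partial>?P) = (\<integral>p. fp p - trunc_log (real K) L (fst p) (snd p) \<partial>?P)"
      using eq by (intro integral_cong_AE) auto
    also have "\<dots> = (\<integral>p. fp p \<partial>?P) - (\<integral>p. trunc_log (real K) L (fst p) (snd p) \<partial>?P)"
      using int_fp int_k by simp
    also have "(\<integral>p. trunc_log (real K) L (fst p) (snd p) \<partial>?P) = (\<integral>x. \<integral>y. trunc_log K L x y \<partial>\<mu> \<partial>\<mu>)"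
      using pair.integral_fst'[OF int_k[of K]] by simp
    finally show ?thesis using ge[of K] by simp
  qed
  define fm where "fm p = (if fst p = snd p then \<infinity> else ennreal (max 0 (- ln (d p))))" for p
  have nn_g: "(\<integral>\<^sup>+p. ennreal (g K p) \<partial>?P) \<le> ennreal ((\<integral>p. fp p \<partial>?P) - c)" for K
    using int_g_le[of K] int_g[of K] by (subst nn_integral_eq_integral) (auto intro!: ennreal_leI, simp add: g_def)
  \<comment> \<open>On the diagonal \<open>g K\<close> equals \<open>K\<close>, with infinite
    supremum; elsewhere the truncation from below is inactive for large \<open>K\<close>.\<close>
  have fm_le: "fm p \<le> (SUP K. ennreal (g K p))" if "fst p \<in> X \<and> snd p \<in> X" for p
  proof (cases "fst p = snd p")
    case True
    have "g K p = real K" for K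
      using True by (auto simp: g_def trunc_log_def min_def max_def)
    thus ?thesis by (simp add: ennreal_SUP_of_nat_eq_top ennreal_of_nat_eq_real_of_nat[symmetric])
  next
    case False
    hence dp: "d p > 0" by (simp add: d_def)
    obtain K :: nat where K: "- ln (d p) \<le> real K" using real_arch_simple by blast
    hence "exp (- real K) \<le> d p" using dp by (smt (verit) exp_le_cancel_iff exp_ln)
    moreover have "min (exp L) (d p) = d p" using L(2) that by (auto simp: d_def)
    ultimately have "trunc_log (real K) L (fst p) (snd p) = ln (d p)"
      by (simp add: trunc_log_def d_def)
    hence "fm p = ennreal (g K p)" using False by (simp add: fm_def g_def)
    thus ?thesis by (auto intro: SUP_upper)
  qed
  have "(\<integral>\<^sup>+p. fm p \<partial>?P) \<le> (\<integral>\<^sup>+p. (SUP K. ennreal (g K p)) \<partial>?P)"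
    using AEX fm_le by (intro nn_integral_mono_AE) (auto elim: eventually_mono)
  also have "\<dots> = (SUP K. \<integral>\<^sup>+p. ennreal (g K p) \<partial>?P)"
  proof (rule nn_integral_monotone_convergence_SUP)
    show "incseq (\<lambda>K p. ennreal (g K p))"
    proof (intro incseq_SucI le_funI ennreal_leI)
      fix K p
      have "trunc_log (real (Suc K)) L (fst p) (snd p) \<le> trunc_log (real K) L (fst p) (snd p)"
        unfolding trunc_log_def
        by (intro ln_le_cancel_iff[THEN iffD2] max.mono order_refl) (simp_all add: less_max_iff_disj)
      thus "g K p \<le> g (Suc K) p" by (simp add: g_def)
    qed
  qed measurable
  also have "\<dots> \<le> ennreal ((\<integral>p. fp p \<partial>?P) - c)" by (intro SUP_least nn_g)
  finally have fm: "(\<integral>\<^sup>+p. fm p \<partial>?P) \<le> ennreal ((\<integral>p. fp p \<partial>?P) - c)" .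
  \<comment> \<open>\<open>ennreal\<close> sends negative numbers to 0, so the sign must be known
    before the bound is read back as a real one.\<close>
  have "(\<integral>p. g 0 p \<partial>?P) \<ge> 0" by (intro Bochner_Integration.integral_nonneg) (auto simp: g_def)
  hence nonneg: "(\<integral>p. fp p \<partial>?P) - c \<ge> 0" using int_g_le[of 0] by linarith
  have fpE: "(\<integral>\<^sup>+p. ennreal (fp p) \<partial>?P) = ennreal (\<integral>p. fp p \<partial>?P)"
    using int_fp by (rule nn_integral_eq_integral) (simp add: fp_def)
  have "(\<integral>p. fp p \<partial>?P) \<ge> 0" by (intro Bochner_Integration.integral_nonneg) (auto simp: fp_def)
  have "enn2ereal (\<integral>\<^sup>+p. fm p \<partial>?P) \<le> enn2ereal (ennreal ((\<integral>p. fp p \<partial>?P) - c))"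
    using fm by (simp add: less_eq_ennreal.rep_eq)
  also have "\<dots> = ereal ((\<integral>p. fp p \<partial>?P) - c)" using nonneg by (simp add: enn2ereal_ennreal)
  finally have "ereal (\<integral>p. fp p \<partial>?P) - ereal ((\<integral>p. fp p \<partial>?P) - c) \<le> ereal (\<integral>p. fp p \<partial>?P) - enn2ereal (\<integral>\<^sup>+p. fm p \<partial>?P)"
    by (intro ereal_minus_mono) auto
  moreover have "log_energy \<mu> = ereal (\<integral>p. fp p \<partial>?P) - enn2ereal (\<integral>\<^sup>+p. fm p \<partial>?P)"
  proof -
    have "log_energy \<mu> = enn2ereal (\<integral>\<^sup>+p. ennreal (fp p) \<partial>?P) - enn2ereal (\<integral>\<^sup>+p. fm p \<partial>?P)"
      unfolding log_energy_def fp_def fm_def d_def ..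
    thus ?thesis unfolding fpE using \<open>(\<integral>p. fp p \<partial>?P) \<ge> 0\<close> by (simp add: enn2ereal_ennreal)
  qed
  ultimately show ?thesis by simp
qed

text \<open>The point sets get arbitrarily large, so a weak limit of their uniform measures exists
  along a subsequence and no longer feels the diagonal terms: for every truncation its energy is at
  least \<open>c\<close>.\<close>

theorem log_energy_sup_ge_of_frequently:
  fixes X :: "complex set"
  assumes X: "compact X" "X \<noteq> {}"
    and freq: "\<And>N. \<exists>m>N. \<exists>z. (\<forall>i<m. z i \<in> X) \<and> pair_prod m z \<ge> exp (c * (real m * (real m - 1)))"
  shows "log_energy_sup X \<ge> ereal c"
proof -
  obtain a where a: "a \<in> X" using X by auto
  have "\<exists>m z. m > N \<and> (\<forall>i. z i \<in> X) \<and> pair_prod m z \<ge> exp (c * (real m * (real m - 1)))" for N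
  proof -
    obtain m z where mz: "m > N" "\<forall>i<m. z i \<in> X" "pair_prod m z \<ge> exp (c * (real m * (real m - 1)))"
      using freq[of N] by auto
    \<comment> \<open>The weak limit is formed for sequences that lie in \<open>X\<close> at every
      index, so the values from \<open>m\<close> on are replaced by \<open>a\<close>.\<close>
    define z' where "z' i = (if i < m then z i else a)" for i
    have "pair_prod m z' = pair_prod m z"
      unfolding pair_prod_def z'_def by (intro prod.cong) auto
    thus ?thesis using mz a by (intro exI[of _ m] exI[of _ z']) (auto simp: z'_def)
  qed
  then obtain m z where m: "\<And>N. m N > N" and z: "\<And>N i. z N i \<in> X"
    and big: "\<And>N. pair_prod (m N) (z N) \<ge> exp (c * (real (m N) * (real (m N) - 1)))"
    by metis
  have m0: "m N > 0" for N using m[of N] by simp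
  obtain \<Omega> :: "real measure" and Y Y' and r :: "nat \<Rightarrow> nat" where
    \<Omega>: "prob_space \<Omega>" "strict_mono r" and Y[measurable]: "\<And>n. Y n \<in> borel_measurable \<Omega>" "Y' \<in> borel_measurable \<Omega>"
    and dY: "\<And>n. distr \<Omega> borel (Y n) = distr (pmf_of_set {..<m (r n)}) borel (z (r n))"
    and lim: "\<And>x. x \<in> space \<Omega> \<Longrightarrow> (\<lambda>n. Y n x) \<longlonglongrightarrow> Y' x"
    and AE: "AE x in \<Omega>. Y' x \<in> X"
    by (rule skorohod_subsequence_uniform[OF X(1) m0 z]) (rule that)
  interpret prob_space \<Omega> by fact
  obtain B where B: "\<And>x. x \<in> X \<Longrightarrow> cmod x \<le> B" using compact_imp_bounded[OF X(1)] by (auto simp: bounded_iff)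
  \<comment> \<open>\<open>2 * B\<close> bounds the diameter of \<open>X\<close>; the maximum with 1
    makes \<open>L\<close> nonnegative.\<close>
  define L where "L = ln (max 1 (2 * B))"
  have L0: "L \<ge> 0" by (simp add: L_def)
  have L: "cmod (x - y) \<le> exp L" if "x \<in> X" "y \<in> X" for x y
    using B[OF that(1)] B[OF that(2)] norm_triangle_ineq4[of x y] by (simp add: L_def)
  have Xb[measurable]: "X \<in> sets borel" using X by (simp add: compact_imp_closed)
  define \<mu> where "\<mu> = distr \<Omega> borel Y'"
  have [measurable_cong]: "sets \<mu> = sets borel" by (simp add: \<mu>_def)
  have "emeasure \<mu> (UNIV - X) = emeasure \<Omega> (Y' -` (UNIV - X) \<inter> space \<Omega>)"
    unfolding \<mu>_def by (subst emeasure_distr) auto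
  also have "Y' -` (UNIV - X) \<inter> space \<Omega> = {x \<in> space \<Omega>. Y' x \<notin> X}" by auto
  also have "emeasure \<Omega> {x \<in> space \<Omega>. Y' x \<notin> X} = 0"
    using AE by (subst AE_iff_measurable[OF _ refl, symmetric]) auto
  finally have \<mu>: "\<mu> \<in> prob_measures_on X"
    unfolding prob_measures_on_def \<mu>_def by (auto intro: prob_space_distr)
  have ge: "(\<integral>x. \<integral>y. trunc_log (real K) L x y \<partial>\<mu> \<partial>\<mu>) \<ge> c" for K :: nat
  proof -
    have "(\<lambda>n. \<integral>x. \<integral>y. trunc_log K L (Y n x) (Y n y) \<partial>\<Omega> \<partial>\<Omega>)
      \<longlonglongrightarrow> (\<integral>x. \<integral>y. trunc_log K L (Y' x) (Y' y) \<partial>\<Omega> \<partial>\<Omega>)"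
      by (rule integral_trunc_log_tendsto) (use lim L0 in auto)
    \<comment> \<open>\<open>K\<close> stays fixed here, so the diagonal loss vanishes as the number
      of points grows.\<close>
    moreover have "(\<lambda>n. c - (c + real K) / real (m (r n))) \<longlonglongrightarrow> c - 0"
    proof (intro tendsto_intros tendsto_divide_0[OF tendsto_const])
      have "filterlim (\<lambda>n. m (r n)) at_top sequentially"
      proof (rule filterlim_at_top_mono[OF filterlim_ident])
        show "\<forall>\<^sub>F n in sequentially. n \<le> m (r n)"
          using m strict_mono_imp_increasing[OF \<Omega>(2)] by (intro always_eventually) (metis le_trans less_imp_le)
      qed
      thus "filterlim (\<lambda>n. real (m (r n))) at_infinity sequentially"
        by (intro filterlim_at_top_imp_at_infinity filterlim_compose[OF filterlim_real_sequentially])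
    qed
    moreover have "c - (c + real K) / real (m (r n)) \<le> (\<integral>x. \<integral>y. trunc_log K L (Y n x) (Y n y) \<partial>\<Omega> \<partial>\<Omega>)" for n
    proof -
      have "(\<integral>x. \<integral>y. trunc_log K L (Y n x) (Y n y) \<partial>\<Omega> \<partial>\<Omega>) =
        (\<Sum>i<m (r n). \<Sum>j<m (r n). trunc_log K L (z (r n) i) (z (r n) j)) / real (m (r n)) ^ 2"
        by (rule integral_uniform_trunc_log[OF _ dY]) (use m0 L0 in auto)
      thus ?thesis
        using sum_trunc_log_ge[OF big m0, of "r n" L "real K"] L z L0 by simp
    qed
    ultimately have "c \<le> (\<integral>x. \<integral>y. trunc_log K L (Y' x) (Y' y) \<partial>\<Omega> \<partial>\<Omega>)"
      by (intro LIMSEQ_le[of _ "c" ]) auto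
    also have "\<dots> = (\<integral>x. \<integral>y. trunc_log K L x y \<partial>\<mu> \<partial>\<mu>)"
      unfolding \<mu>_def by (subst (1 2) integral_distr) auto
    finally show ?thesis .
  qed
  have "ereal c \<le> log_energy \<mu>" by (rule log_energy_ge[OF \<mu> Xb L0 L ge])
  also have "\<dots> \<le> log_energy_sup X" unfolding log_energy_sup_def using \<mu> by (rule SUP_upper)
  finally show ?thesis .
qed

section \<open>Norms and Rayleigh quotients\<close>

lemma cmod_sum_mult_sq_le:
  fixes a b :: "'i \<Rightarrow> complex"
  shows "(cmod (\<Sum>i\<in>I. a i * b i))\<^sup>2 \<le> (\<Sum>i\<in>I. (cmod (a i))\<^sup>2) * (\<Sum>i\<in>I. (cmod (b i))\<^sup>2)"
proof -
  have "cmod (\<Sum>i\<in>I. a i * b i) \<le> (\<Sum>i\<in>I. cmod (a i) * cmod (b i))"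
    by (rule order_trans[OF norm_sum]) (simp add: norm_mult)
  hence "(cmod (\<Sum>i\<in>I. a i * b i))\<^sup>2 \<le> (\<Sum>i\<in>I. cmod (a i) * cmod (b i))\<^sup>2"
    by (intro power_mono) auto
  also have "\<dots> \<le> (\<Sum>i\<in>I. (cmod (a i))\<^sup>2) * (\<Sum>i\<in>I. (cmod (b i))\<^sup>2)"
    by (rule Cauchy_Schwarz_ineq_sum)
  finally show ?thesis .
qed

lemma mult_mat_vec_index:
  assumes "i < dim_row M" "dim_vec x = dim_col M"
  shows "(M *\<^sub>v x) $ i = (\<Sum>j<dim_col M. M $$ (i, j) * x $ j)"
  using assms by (simp add: scalar_prod_def atLeast0LessThan)

lemma mult_mat_index:
  assumes "i < dim_row M" "j < dim_col N" "dim_row N = dim_col M"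
  shows "(M * N) $$ (i, j) = (\<Sum>l<dim_col M. M $$ (i, l) * N $$ (l, j))"
  using assms by (simp add: scalar_prod_def atLeast0LessThan)

lemma vec_2norm_sq: "(vec_2norm x)\<^sup>2 = (\<Sum>i<dim_vec x. (cmod (x $ i))\<^sup>2)"
  unfolding vec_2norm_def by (simp add: sum_nonneg)

lemma vec_2norm_nonneg: "vec_2norm x \<ge> 0"
  unfolding vec_2norm_def by (simp add: sum_nonneg)

lemma frob_norm_sq: "(frob_norm M)\<^sup>2 = (\<Sum>i<dim_row M. \<Sum>j<dim_col M. (cmod (M $$ (i, j)))\<^sup>2)"
  unfolding frob_norm_def by (simp add: sum_nonneg)

lemma frob_norm_nonneg: "frob_norm M \<ge> 0"
  unfolding frob_norm_def by (simp add: sum_nonneg)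

lemma vec_2norm_smult: "vec_2norm (a \<cdot>\<^sub>v x) = cmod a * vec_2norm x"
proof -
  have "(vec_2norm (a \<cdot>\<^sub>v x))\<^sup>2 = (cmod a * vec_2norm x)\<^sup>2"
    by (simp add: vec_2norm_sq power_mult_distrib norm_mult sum_distrib_left)
  thus ?thesis by (rule power2_eq_imp_eq) (auto simp: vec_2norm_nonneg)
qed

lemma vec_2norm_pos:
  assumes "x \<in> carrier_vec n" "x \<noteq> 0\<^sub>v n"
  shows "vec_2norm x > 0"
proof -
  obtain i where i: "i < n" "x $ i \<noteq> 0" using assms by (metis carrier_vecD eq_vecI index_zero_vec)
  have "0 < (cmod (x $ i))\<^sup>2" using i by simp
  also have "\<dots> \<le> (vec_2norm x)\<^sup>2"
    unfolding vec_2norm_sq by (rule member_le_sum) (use assms i in auto)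
  finally show ?thesis using vec_2norm_nonneg[of x] by (simp add: zero_less_power2)
qed

lemma vec_2norm_mult_le_frob:
  assumes "x \<in> carrier_vec (dim_col M)"
  shows "vec_2norm (M *\<^sub>v x) \<le> frob_norm M * vec_2norm x"
proof -
  have "(vec_2norm (M *\<^sub>v x))\<^sup>2 = (\<Sum>i<dim_row M. (cmod (\<Sum>j<dim_col M. M $$ (i, j) * x $ j))\<^sup>2)"
    unfolding vec_2norm_sq using assms
    by (auto intro!: sum.cong simp del: index_mult_mat_vec simp: mult_mat_vec_index)
  also have "\<dots> \<le> (\<Sum>i<dim_row M. (\<Sum>j<dim_col M. (cmod (M $$ (i, j)))\<^sup>2) * (vec_2norm x)\<^sup>2)"
    unfolding vec_2norm_sq using assms by (auto intro!: sum_mono cmod_sum_mult_sq_le)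
  also have "\<dots> = (frob_norm M * vec_2norm x)\<^sup>2"
    by (simp add: power_mult_distrib frob_norm_sq sum_distrib_right)
  finally show ?thesis
    by (rule power2_le_imp_le) (simp add: frob_norm_nonneg vec_2norm_nonneg)
qed

lemma spec_norm_upper:
  assumes "x \<in> carrier_vec (dim_col M)" "vec_2norm x \<le> 1"
  shows "vec_2norm (M *\<^sub>v x) \<le> spec_norm M"
  unfolding spec_norm_def
proof (rule cSUP_upper)
  \<comment> \<open>The real \<open>SUP\<close> is informative only on a bounded set; the Frobenius
    norm supplies a bound.\<close>
  show "bdd_above ((\<lambda>x. vec_2norm (M *\<^sub>v x)) ` {x \<in> carrier_vec (dim_col M). vec_2norm x \<le> 1})"
  proof (rule bdd_aboveI2)
    fix x assume x: "x \<in> {x \<in> carrier_vec (dim_col M). vec_2norm x \<le> 1}"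
    have "vec_2norm (M *\<^sub>v x) \<le> frob_norm M * vec_2norm x" using x by (intro vec_2norm_mult_le_frob) auto
    also have "\<dots> \<le> frob_norm M * 1" using x by (intro mult_left_mono) (auto simp: frob_norm_nonneg)
    finally show "vec_2norm (M *\<^sub>v x) \<le> frob_norm M" by simp
  qed
qed (use assms in auto)

lemma spec_norm_bound:
  assumes x: "x \<in> carrier_vec (dim_col M)"
  shows "vec_2norm (M *\<^sub>v x) \<le> spec_norm M * vec_2norm x"
proof (cases "x = 0\<^sub>v (dim_col M)")
  case True
  have "vec_2norm x = 0" using True by (simp add: vec_2norm_def)
  thus ?thesis using vec_2norm_mult_le_frob[OF x] by simp
next
  case False
  hence pos: "vec_2norm x > 0" using vec_2norm_pos x by blast
  define a where "a = complex_of_real (1 / vec_2norm x)"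
  have "vec_2norm (M *\<^sub>v (a \<cdot>\<^sub>v x)) \<le> spec_norm M"
    using x pos by (intro spec_norm_upper) (auto simp: vec_2norm_smult a_def norm_divide)
  also have "M *\<^sub>v (a \<cdot>\<^sub>v x) = a \<cdot>\<^sub>v (M *\<^sub>v x)" using x by (intro mult_mat_vec) auto
  finally show ?thesis using pos by (simp add: vec_2norm_smult a_def norm_divide field_simps)
qed

text \<open>With \<open>y\<close> the adjoint of \<open>M\<close> applied to \<open>x\<close>, the
  squared norm of \<open>y\<close> is the inner product of \<open>x\<close> with
  \<open>M *\<^sub>v y\<close>. Cauchy-Schwarz bounds it by the norms of \<open>x\<close>,
  \<open>M\<close> and \<open>y\<close>, and the norm of \<open>y\<close> cancels.\<close>

lemma spec_norm_bound_adjoint: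
  assumes x: "x \<in> carrier_vec (dim_row M)"
  shows "(\<Sum>j<dim_col M. (cmod (\<Sum>i<dim_row M. cnj (x $ i) * M $$ (i, j)))\<^sup>2)
      \<le> (spec_norm M)\<^sup>2 * (vec_2norm x)\<^sup>2"
proof -
  define u where "u j = (\<Sum>i<dim_row M. cnj (x $ i) * M $$ (i, j))" for j
  define y where "y = vec (dim_col M) (\<lambda>j. cnj (u j))"
  have y: "y \<in> carrier_vec (dim_col M)" by (simp add: y_def)
  have S: "(\<Sum>j<dim_col M. (cmod (u j))\<^sup>2) = (vec_2norm y)\<^sup>2"
    unfolding vec_2norm_sq by (simp add: y_def)
  have "complex_of_real ((vec_2norm y)\<^sup>2) = (\<Sum>j<dim_col M. u j * cnj (u j))"
    unfolding S[symmetric] by (simp only: of_real_sum complex_norm_square)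
  also have "\<dots> = (\<Sum>j<dim_col M. \<Sum>i<dim_row M. cnj (x $ i) * (M $$ (i, j) * y $ j))"
    by (auto simp: u_def[of _] sum_distrib_right y_def mult.assoc intro!: sum.cong)
  also have "\<dots> = (\<Sum>i<dim_row M. cnj (x $ i) * (M *\<^sub>v y) $ i)"
    using y by (subst sum.swap) (auto simp: mult_mat_vec_index sum_distrib_left simp del: index_mult_mat_vec)
  finally have "(cmod (complex_of_real ((vec_2norm y)\<^sup>2)))\<^sup>2 \<le>
      (\<Sum>i<dim_row M. (cmod (cnj (x $ i)))\<^sup>2) * (\<Sum>i<dim_row M. (cmod ((M *\<^sub>v y) $ i))\<^sup>2)"
    using cmod_sum_mult_sq_le by metis
  also have "\<dots> = (vec_2norm x)\<^sup>2 * (vec_2norm (M *\<^sub>v y))\<^sup>2"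
    using x by (simp add: vec_2norm_sq)
  also have "\<dots> \<le> (vec_2norm x)\<^sup>2 * (spec_norm M * vec_2norm y)\<^sup>2"
    using y by (intro mult_left_mono power_mono spec_norm_bound) (auto simp: vec_2norm_nonneg)
  finally have le: "(vec_2norm y)\<^sup>2 * (vec_2norm y)\<^sup>2 \<le> ((spec_norm M)\<^sup>2 * (vec_2norm x)\<^sup>2) * (vec_2norm y)\<^sup>2"
    by (simp add: power2_eq_square mult_ac norm_mult)
  have "(vec_2norm y)\<^sup>2 \<le> (spec_norm M)\<^sup>2 * (vec_2norm x)\<^sup>2"
  proof (cases "vec_2norm y = 0")
    case False
    hence "(vec_2norm y)\<^sup>2 > 0" by simp
    thus ?thesis using le mult_right_le_imp_le by blast
  qed simp
  thus ?thesis unfolding S[symmetric] u_def .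
qed

lemma frob_norm_mult_le:
  assumes "dim_row N = dim_col M"
  shows "(frob_norm (M * N))\<^sup>2 \<le> (spec_norm M)\<^sup>2 * (frob_norm N)\<^sup>2"
proof -
  have col: "(frob_norm N)\<^sup>2 = (\<Sum>c<dim_col N. (vec_2norm (col N c))\<^sup>2)" for N
    unfolding frob_norm_sq vec_2norm_sq by (subst sum.swap) (auto intro!: sum.cong)
  have "col (M * N) c = M *\<^sub>v col N c" if "c < dim_col N" for c
    using assms that by (intro col_mult2[of M "dim_row M" "dim_col M" N "dim_col N"]) auto
  hence "(frob_norm (M * N))\<^sup>2 = (\<Sum>c<dim_col N. (vec_2norm (M *\<^sub>v col N c))\<^sup>2)"
    unfolding col by (intro sum.cong) auto
  also have "\<dots> \<le> (\<Sum>c<dim_col N. (spec_norm M * vec_2norm (col N c))\<^sup>2)"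
    by (intro sum_mono power_mono spec_norm_bound) (auto simp: vec_2norm_nonneg assms[symmetric])
  also have "\<dots> = (spec_norm M)\<^sup>2 * (frob_norm N)\<^sup>2"
    unfolding col by (simp add: power_mult_distrib sum_distrib_left)
  finally show ?thesis .
qed

section \<open>The smallest eigenvalue as the minimum of a quadratic form\<close>

definition sesq :: "nat \<Rightarrow> (nat \<Rightarrow> nat \<Rightarrow> complex) \<Rightarrow> (nat \<Rightarrow> complex) \<Rightarrow> (nat \<Rightarrow> complex) \<Rightarrow> complex" where
  "sesq n w f g = (\<Sum>i<n. \<Sum>j<n. cnj (f i) * w i j * g j)"

lemma sesq_commute:
  assumes "\<And>i j. i < n \<Longrightarrow> j < n \<Longrightarrow> w i j = cnj (w j i)"
  shows "sesq n w f g = cnj (sesq n w g f)"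
proof -
  have "cnj (sesq n w g f) = (\<Sum>i<n. \<Sum>j<n. cnj (f j) * w j i * g i)"
    unfolding sesq_def cnj_sum
  proof (intro sum.cong refl)
    fix i j assume "i \<in> {..<n}" "j \<in> {..<n}"
    hence "w j i = cnj (w i j)" using assms by blast
    thus "cnj (cnj (g i) * w i j * f j) = cnj (f j) * w j i * g i" by simp
  qed
  also have "\<dots> = sesq n w f g" unfolding sesq_def by (rule sum.swap)
  finally show ?thesis by simp
qed

lemma sesq_diff:
  "sesq n w (\<lambda>i. f i - of_real s * h i) (\<lambda>i. f i - of_real s * h i) =
    sesq n w f f - of_real s * (sesq n w f h + sesq n w h f) + of_real (s\<^sup>2) * sesq n w h h"
proof -
  have "sesq n w (\<lambda>i. f i - of_real s * h i) (\<lambda>i. f i - of_real s * h i) =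
    (\<Sum>i<n. \<Sum>j<n. (cnj (f i) * w i j * f j - of_real s * (cnj (f i) * w i j * h j))
       - of_real s * (cnj (h i) * w i j * f j) + of_real (s\<^sup>2) * (cnj (h i) * w i j * h j))"
    unfolding sesq_def by (intro sum.cong refl) (simp add: algebra_simps power2_eq_square)
  also have "\<dots> = sesq n w f f - of_real s * sesq n w f h - of_real s * sesq n w h f
      + of_real (s\<^sup>2) * sesq n w h h"
    unfolding sesq_def by (simp only: sum.distrib sum_subtractf sum_distrib_left)
  finally show ?thesis by (simp only: distrib_left diff_diff_eq)
qed

text \<open>Perturb \<open>f\<close> against its image \<open>h\<close>: nonnegativity of the form
  at \<open>f - s h\<close> gives \<open>2 * N \<le> s * Q\<close> for all \<open>s > 0\<close>,
  where \<open>N\<close> is the squared norm of \<open>h\<close>. Small \<open>s\<close> forces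
  \<open>N\<close> to vanish.\<close>

lemma sesq_psd_null:
  assumes herm: "\<And>i j. i < n \<Longrightarrow> j < n \<Longrightarrow> w i j = cnj (w j i)"
    and psd: "\<And>g. Re (sesq n w g g) \<ge> 0" and f: "Re (sesq n w f f) \<le> 0" and i: "i < n"
  shows "(\<Sum>j<n. w i j * f j) = 0"
proof -
  define h where "h i = (\<Sum>j<n. w i j * f j)" for i
  define N where "N = (\<Sum>i<n. (cmod (h i))\<^sup>2)"
  have "sesq n w h f = (\<Sum>i<n. cnj (h i) * (\<Sum>j<n. w i j * f j))"
    unfolding sesq_def by (simp only: sum_distrib_left mult.assoc)
  also have "\<dots> = (\<Sum>i<n. h i * cnj (h i))"
    unfolding h_def[symmetric] by (simp only: mult.commute)
  also have "\<dots> = of_real N" unfolding N_def by (simp only: of_real_sum complex_norm_square)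
  finally have hf: "Re (sesq n w h f) = N" by simp
  have fh: "Re (sesq n w f h) = N" by (subst sesq_commute[OF herm]) (auto simp: hf)
  define Q where "Q = Re (sesq n w h h)"
  have key: "2 * N \<le> s * Q" if "s > 0" for s
  proof -
    have "0 \<le> Re (sesq n w (\<lambda>i. f i - of_real s * h i) (\<lambda>i. f i - of_real s * h i))" by (rule psd)
    also have "\<dots> = Re (sesq n w f f) - s * (N + N) + s\<^sup>2 * Q"
      unfolding sesq_diff Q_def by (simp add: fh hf)
    finally have "s * (2 * N) \<le> s * (s * Q)" using f by (simp add: power2_eq_square)
    thus ?thesis using that by simp
  qed
  have "N \<le> 0"
  proof (rule ccontr)
    assume "\<not> N \<le> 0"
    hence N: "N > 0" by simp
    have "Q > 0" using key[of 1] N by simp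
    thus False using key[of "N / Q"] N by simp
  qed
  moreover have "(cmod (h i))\<^sup>2 \<le> N" unfolding N_def by (rule member_le_sum) (use i in auto)
  ultimately have "(cmod (h i))\<^sup>2 \<le> 0" by linarith
  thus ?thesis by (simp add: h_def)
qed

text \<open>The minimum \<open>m\<close> of the form on the unit sphere is itself an eigenvalue:
  subtracting \<open>m\<close> on the diagonal leaves a positive semidefinite form that is null at
  the minimizer, so by \<open>sesq_psd_null\<close> the minimizer is an eigenvector.\<close>

lemma lambda_min_le_rayleigh:
  fixes W :: "complex mat"
  assumes W: "W \<in> carrier_mat n n"
    and herm: "\<And>i j. i < n \<Longrightarrow> j < n \<Longrightarrow> W $$ (i, j) = cnj (W $$ (j, i))"
    and x: "x \<in> carrier_vec n" "vec_2norm x = 1"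
  shows "lambda_min W \<le> Re (\<Sum>i<n. \<Sum>j<n. cnj (x $ i) * W $$ (i, j) * x $ j)"
proof -
  define w where "w i j = W $$ (i, j)" for i j
  define nsq where "nsq f = (\<Sum>i<n. (cmod (f i))\<^sup>2)" for f :: "nat \<Rightarrow> complex"
  define q where "q f = Re (sesq n w f f)" for f
  \<comment> \<open>Vectors become functions on \<open>nat\<close> pinned to 0 from \<open>n\<close>
    on, so that compactness comes from the product topology.\<close>
  define S where "S = {f. \<forall>i. f i \<in> (if i < n then cball 0 1 else {0::complex})} \<inter> {f. nsq f = 1}"
  have coord: "continuous_on T (\<lambda>f::nat \<Rightarrow> complex. f i)" for T i
    by (intro continuous_on_product_then_coordinatewise[OF continuous_on_id])
  have cn: "continuous_on T nsq" for T unfolding nsq_def by (intro continuous_intros coord)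
  have cq: "continuous_on T q" for T unfolding q_def sesq_def by (intro continuous_intros coord)
  have memS: "(\<lambda>i. if i < n then f i else 0) \<in> S" if "nsq f = 1" for f
  proof -
    have "cmod (f i) \<le> 1" if "i < n" for i
    proof -
      have "(cmod (f i))\<^sup>2 \<le> nsq f" unfolding nsq_def by (rule member_le_sum) (use that in auto)
      thus ?thesis using \<open>nsq f = 1\<close> by (simp add: power_le_one_iff abs_square_le_1)
    qed
    thus ?thesis using that by (auto simp: S_def nsq_def)
  qed
  have qrestr: "q (\<lambda>i. if i < n then f i else 0) = q f" for f
    unfolding q_def sesq_def by (intro arg_cong[where f=Re] sum.cong) auto
  have "compact S" unfolding S_def
  proof (rule compact_Int_closed)
    show "compact {f. \<forall>i. f i \<in> (if i < n then cball 0 1 else {0::complex})}"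
      by (rule compact_function_box) auto
    show "closed {f. nsq f = 1}" by (intro closed_Collect_eq cn continuous_on_const)
  qed
  moreover have nx: "nsq (\<lambda>i. x $ i) = 1" using x vec_2norm_sq[of x] by (simp add: nsq_def)
  hence "S \<noteq> {}" using memS by blast
  ultimately obtain f where f: "f \<in> S" and fmin: "\<And>g. g \<in> S \<Longrightarrow> q f \<le> q g"
    using continuous_attains_inf[OF _ _ cq] by metis
  define m where "m = q f"
  have min1: "m \<le> q g" if "nsq g = 1" for g
    using fmin[OF memS[OF that]] by (simp add: m_def qrestr)
  define w' where "w' i j = w i j - (if i = j then of_real m else 0)" for i j
  have sesq': "sesq n w' g g = sesq n w g g - of_real (m * nsq g)" for g
  proof -
    have "sesq n w' g g = (\<Sum>i<n. \<Sum>j<n. cnj (g i) * w i j * g j - (if j = i then of_real m * (g i * cnj (g i)) else 0))"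
      unfolding sesq_def w'_def by (intro sum.cong refl) (simp add: algebra_simps)
    also have "\<dots> = sesq n w g g - (\<Sum>i<n. \<Sum>j<n. if j = i then of_real m * (g i * cnj (g i)) else 0)"
      by (simp only: sum_subtractf sesq_def)
    also have "(\<Sum>i<n. \<Sum>j<n. if j = i then of_real m * (g i * cnj (g i)) else 0) = (\<Sum>i<n. of_real m * (g i * cnj (g i)))"
      by (intro sum.cong refl) (simp add: sum.delta)
    also have "\<dots> = of_real (m * nsq g)"
      unfolding nsq_def by (simp only: of_real_mult of_real_sum complex_norm_square sum_distrib_left)
    finally show ?thesis .
  qed
  have psd: "Re (sesq n w' g g) \<ge> 0" for g
  proof (cases "nsq g = 0")
    case True
    hence "\<forall>i<n. g i = 0" unfolding nsq_def by (subst (asm) sum_nonneg_eq_0_iff) auto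
    hence "sesq n w' g g = 0" unfolding sesq_def by simp
    thus ?thesis by simp
  next
    case False
    have "nsq g \<ge> 0" unfolding nsq_def by (simp add: sum_nonneg)
    with False have pos: "nsq g > 0" by simp
    define a where "a = 1 / sqrt (nsq g)"
    have a2: "a\<^sup>2 * nsq g = 1" using pos by (simp add: a_def power_divide)
    have "nsq (\<lambda>i. of_real a * g i) = a\<^sup>2 * nsq g"
      by (simp add: nsq_def norm_mult power_mult_distrib sum_distrib_left)
    hence "m \<le> q (\<lambda>i. of_real a * g i)" using a2 by (intro min1) simp
    also have "sesq n w (\<lambda>i. of_real a * g i) (\<lambda>i. of_real a * g i) = of_real (a\<^sup>2) * sesq n w g g"
      by (simp add: sesq_def sum_distrib_left power2_eq_square mult_ac)
    hence "q (\<lambda>i. of_real a * g i) = a\<^sup>2 * q g" by (simp add: q_def)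
    finally have "a\<^sup>2 * (m * nsq g) \<le> a\<^sup>2 * q g" using a2 by (simp add: mult.left_commute)
    moreover have "a\<^sup>2 > 0" using pos by (simp add: a_def)
    ultimately have "m * nsq g \<le> q g" by simp
    thus ?thesis by (simp add: sesq' q_def)
  qed
  have nf: "nsq f = 1" using f by (simp add: S_def)
  have eig: "(\<Sum>j<n. w' i j * f j) = 0" if "i < n" for i
  proof (rule sesq_psd_null[OF _ psd _ that])
    show "i < n \<Longrightarrow> j < n \<Longrightarrow> w' i j = cnj (w' j i)" for i j
      using herm[of i j] by (simp add: w'_def w_def)
    show "Re (sesq n w' f f) \<le> 0" using nf by (simp add: sesq' m_def q_def)
  qed
  define v where "v = vec n f"
  have "W *\<^sub>v v = of_real m \<cdot>\<^sub>v v"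
  proof (rule eq_vecI)
    fix i assume "i < dim_vec (of_real m \<cdot>\<^sub>v v)"
    hence i: "i < n" by (simp add: v_def)
    have "(W *\<^sub>v v) $ i = (\<Sum>j<n. w i j * f j)"
      using W i by (subst mult_mat_vec_index) (auto simp: v_def w_def)
    also have "\<dots> = (\<Sum>j<n. w' i j * f j + (if j = i then of_real m * f i else 0))"
      unfolding w'_def by (intro sum.cong refl) (simp add: algebra_simps)
    also have "\<dots> = (\<Sum>j<n. w' i j * f j) + (\<Sum>j<n. if j = i then of_real m * f i else 0)"
      by (rule sum.distrib)
    finally show "(W *\<^sub>v v) $ i = (of_real m \<cdot>\<^sub>v v) $ i"
      using eig[OF i] i by (simp add: v_def sum.delta)
  qed (use W in \<open>auto simp: v_def\<close>)
  moreover have "v \<noteq> 0\<^sub>v n"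
  proof
    assume "v = 0\<^sub>v n"
    hence "f i = 0" if "i < n" for i using that by (metis index_vec index_zero_vec(1) v_def)
    hence "nsq f = 0" by (simp add: nsq_def)
    thus False using nf by simp
  qed
  ultimately have "eigenvalue W (of_real m)"
    unfolding eigenvalue_def eigenvector_def using W by (intro exI[of _ v]) (auto simp: v_def)
  \<comment> \<open>Finiteness of the spectrum makes \<open>Min\<close> a lower bound of the
    set.\<close>
  hence "lambda_min W \<le> m"
    unfolding lambda_min_def using card_finite_spectrum(1)[OF W] 
    by (intro Min_le) (auto simp: spectrum_def image_iff intro!: exI[of _ "of_real m"])
  also have "\<dots> \<le> q (\<lambda>i. x $ i)" by (rule min1[OF nx])
  finally show ?thesis by (simp add: q_def sesq_def w_def)
qed

section \<open>The controllability Gramian\<close>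

lemma mat_adjoint_dims [simp]: "dim_row (mat_adjoint A) = dim_col A" "dim_col (mat_adjoint A) = dim_row A"
  by (auto simp: mat_adjoint_def)

lemma mat_adjoint_index [simp]:
  fixes A :: "complex mat"
  shows "i < dim_col A \<Longrightarrow> j < dim_row A \<Longrightarrow> mat_adjoint A $$ (i, j) = cnj (A $$ (j, i))"
  by (simp add: mat_adjoint_def mat_of_rows_def)

lemma mat_adjoint_mult:
  fixes A B :: "complex mat"
  assumes "dim_row B = dim_col A"
  shows "mat_adjoint (A * B) = mat_adjoint B * mat_adjoint A"
  using assms
  by (intro eq_matI) (auto simp: mult_mat_index mult.commute simp del: index_mult_mat(1))

text \<open>Matrix powers append factors on the right; adjoints reverse the order and call for this
  form.\<close>

lemma pow_mat_Suc_left: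
  assumes "A \<in> carrier_mat n n"
  shows "A ^\<^sub>m Suc l = A * A ^\<^sub>m l"
proof (induction l)
  case 0
  show ?case using assms by simp
next
  case (Suc l)
  have "A ^\<^sub>m Suc (Suc l) = (A * A ^\<^sub>m l) * A" using Suc by simp
  also have "\<dots> = A * (A ^\<^sub>m l * A)" using assms by (intro assoc_mult_mat[of _ n n _ n _ n]) auto
  finally show ?case by simp
qed

lemma mat_adjoint_pow:
  fixes A :: "complex mat"
  assumes A: "A \<in> carrier_mat n n"
  shows "mat_adjoint A ^\<^sub>m l = mat_adjoint (A ^\<^sub>m l)"
proof (induction l)
  case 0
  show ?case using A by (intro eq_matI) auto
next
  case (Suc l)
  have "mat_adjoint (A ^\<^sub>m Suc l) = mat_adjoint (A ^\<^sub>m l) * mat_adjoint A"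
    unfolding pow_mat_Suc_left[OF A] using A by (intro mat_adjoint_mult) auto
  thus ?case using Suc by simp
qed

lemma ctrl_gramian_index:
  assumes A: "A \<in> carrier_mat n n" and B: "B \<in> carrier_mat n k" and ij: "i < n" "j < n"
  shows "ctrl_gramian A B t $$ (i, j) =
    (\<Sum>l\<le>t. \<Sum>c<k. (A ^\<^sub>m l * B) $$ (i, c) * cnj ((A ^\<^sub>m l * B) $$ (j, c)))"
proof -
  have "(A ^\<^sub>m l * B * mat_adjoint B * (mat_adjoint A) ^\<^sub>m l) $$ (i, j)
     = (\<Sum>c<k. (A ^\<^sub>m l * B) $$ (i, c) * cnj ((A ^\<^sub>m l * B) $$ (j, c)))" for l
  proof -
    have Al: "A ^\<^sub>m l \<in> carrier_mat n n" using A by simp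
    have "A ^\<^sub>m l * B * mat_adjoint B * (mat_adjoint A) ^\<^sub>m l = A ^\<^sub>m l * B * (mat_adjoint B * mat_adjoint (A ^\<^sub>m l))"
      unfolding mat_adjoint_pow[OF A]
    proof (rule assoc_mult_mat)
      show "A ^\<^sub>m l * B \<in> carrier_mat n k" using Al B by (rule mult_carrier_mat)
      show "mat_adjoint B \<in> carrier_mat k n" "mat_adjoint (A ^\<^sub>m l) \<in> carrier_mat n n"
        using A B by (intro carrier_matI; simp)+
    qed
    also have "mat_adjoint B * mat_adjoint (A ^\<^sub>m l) = mat_adjoint (A ^\<^sub>m l * B)"
      using A B by (intro mat_adjoint_mult[symmetric]) auto
    finally have "(A ^\<^sub>m l * B * mat_adjoint B * (mat_adjoint A) ^\<^sub>m l) $$ (i, j) =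
        (A ^\<^sub>m l * B * mat_adjoint (A ^\<^sub>m l * B)) $$ (i, j)" by (rule arg_cong)
    also have "\<dots> = (\<Sum>c<k. (A ^\<^sub>m l * B) $$ (i, c) * mat_adjoint (A ^\<^sub>m l * B) $$ (c, j))"
      using A B ij by (subst mult_mat_index) simp_all
    also have "\<dots> = (\<Sum>c<k. (A ^\<^sub>m l * B) $$ (i, c) * cnj ((A ^\<^sub>m l * B) $$ (j, c)))"
    proof (intro sum.cong refl)
      fix c assume "c \<in> {..<k}"
      thus "(A ^\<^sub>m l * B) $$ (i, c) * mat_adjoint (A ^\<^sub>m l * B) $$ (c, j)
          = (A ^\<^sub>m l * B) $$ (i, c) * cnj ((A ^\<^sub>m l * B) $$ (j, c))"
        using A B ij by (subst mat_adjoint_index) simp_all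
    qed
    finally show ?thesis .
  qed
  thus ?thesis using A ij by (simp add: ctrl_gramian_def)
qed

text \<open>The swaps move the sums over \<open>i\<close> and \<open>j\<close> innermost, where they
  split into a number times its conjugate.\<close>

lemma gram_form_eq_sum_squares:
  fixes u :: "nat \<Rightarrow> complex"
  shows "(\<Sum>i<n. \<Sum>j<n. cnj (u i) * (\<Sum>l\<le>t. \<Sum>c<k. M l i c * cnj (M l j c)) * u j)
    = of_real (\<Sum>l\<le>t. \<Sum>c<k. (cmod (\<Sum>i<n. cnj (u i) * M l i c))\<^sup>2)"
proof -
  have "(\<Sum>i<n. \<Sum>j<n. cnj (u i) * (\<Sum>l\<le>t. \<Sum>c<k. M l i c * cnj (M l j c)) * u j)
    = (\<Sum>i<n. \<Sum>j<n. \<Sum>l\<le>t. \<Sum>c<k. (cnj (u i) * M l i c) * (cnj (M l j c) * u j))"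
    by (simp only: sum_distrib_left sum_distrib_right mult.assoc)
  also have "\<dots> = (\<Sum>i<n. \<Sum>l\<le>t. \<Sum>j<n. \<Sum>c<k. (cnj (u i) * M l i c) * (cnj (M l j c) * u j))"
    by (intro sum.cong refl sum.swap)
  also have "\<dots> = (\<Sum>l\<le>t. \<Sum>i<n. \<Sum>j<n. \<Sum>c<k. (cnj (u i) * M l i c) * (cnj (M l j c) * u j))"
    by (rule sum.swap)
  also have "\<dots> = (\<Sum>l\<le>t. \<Sum>i<n. \<Sum>c<k. \<Sum>j<n. (cnj (u i) * M l i c) * (cnj (M l j c) * u j))"
    by (intro sum.cong refl sum.swap)
  also have "\<dots> = (\<Sum>l\<le>t. \<Sum>c<k. \<Sum>i<n. \<Sum>j<n. (cnj (u i) * M l i c) * (cnj (M l j c) * u j))"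
    by (intro sum.cong refl sum.swap)
  also have "\<dots> = (\<Sum>l\<le>t. \<Sum>c<k. (\<Sum>i<n. cnj (u i) * M l i c) * cnj (\<Sum>i<n. cnj (u i) * M l i c))"
    by (simp add: sum_product cnj_sum mult.commute[of "cnj (M _ _ _)"])
  also have "\<dots> = of_real (\<Sum>l\<le>t. \<Sum>c<k. (cmod (\<Sum>i<n. cnj (u i) * M l i c))\<^sup>2)"
    by (simp only: of_real_sum complex_norm_square)
  finally show ?thesis .
qed

lemma lambda_min_gramian_le:
  assumes A: "A \<in> carrier_mat n n" and B: "B \<in> carrier_mat n k"
    and x: "x \<in> carrier_vec n" "vec_2norm x = 1"
  shows "lambda_min (ctrl_gramian A B t) \<le> (\<Sum>l\<le>t. \<Sum>c<k. (cmod (\<Sum>i<n. cnj (x $ i) * (A ^\<^sub>m l * B) $$ (i, c)))\<^sup>2)"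
proof -
  have "lambda_min (ctrl_gramian A B t) \<le>
      Re (\<Sum>i<n. \<Sum>j<n. cnj (x $ i) * ctrl_gramian A B t $$ (i, j) * x $ j)"
  proof (rule lambda_min_le_rayleigh[OF _ _ x])
    show "ctrl_gramian A B t \<in> carrier_mat n n" using A by (simp add: ctrl_gramian_def)
    show "i < n \<Longrightarrow> j < n \<Longrightarrow> ctrl_gramian A B t $$ (i, j) = cnj (ctrl_gramian A B t $$ (j, i))" for i j
      by (simp add: ctrl_gramian_index[OF A B] mult.commute)
  qed
  also have "(\<Sum>i<n. \<Sum>j<n. cnj (x $ i) * ctrl_gramian A B t $$ (i, j) * x $ j)
     = (\<Sum>i<n. \<Sum>j<n. cnj (x $ i) * (\<Sum>l\<le>t. \<Sum>c<k. (A ^\<^sub>m l * B) $$ (i, c) * cnj ((A ^\<^sub>m l * B) $$ (j, c))) * x $ j)"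
    by (intro sum.cong refl) (simp add: ctrl_gramian_index[OF A B])
  finally show ?thesis unfolding gram_form_eq_sum_squares by simp
qed

text \<open>The conjugated conditions form the first \<open>m\<close> rows of a square matrix. Row
  \<open>m\<close> is zero, so the determinant vanishes and the kernel contains a nonzero vector,
  which is then normalized.\<close>

lemma unit_vec_orthogonal:
  fixes M :: "nat \<Rightarrow> nat \<Rightarrow> complex"
  assumes "m < n"
  obtains x where "x \<in> carrier_vec n" "vec_2norm x = 1" "\<And>r. r < m \<Longrightarrow> (\<Sum>i<n. cnj (x $ i) * M r i) = 0"
proof -
  define N where "N = mat\<^sub>r n n (\<lambda>r. if r = m then 0\<^sub>v n else vec n (\<lambda>i. if r < m then cnj (M r i) else 0))"
  have N: "N \<in> carrier_mat n n" by (simp add: N_def)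
  have "det N = 0" unfolding N_def by (rule det_row_0[OF assms]) auto
  then obtain v where v: "v \<in> carrier_vec n" "v \<noteq> 0\<^sub>v n" "N *\<^sub>v v = 0\<^sub>v n"
    using det_0_iff_vec_prod_zero[OF N] by blast
  have pos: "vec_2norm v > 0" using vec_2norm_pos v by blast
  define a where "a = complex_of_real (1 / vec_2norm v)"
  show ?thesis
  proof (rule that[of "a \<cdot>\<^sub>v v"])
    show "a \<cdot>\<^sub>v v \<in> carrier_vec n" using v by simp
    show "vec_2norm (a \<cdot>\<^sub>v v) = 1" using pos by (simp add: vec_2norm_smult a_def norm_divide)
    fix r assume r: "r < m"
    hence "0 = (N *\<^sub>v v) $ r" using v assms by simp
    also have "\<dots> = (\<Sum>i<n. N $$ (r, i) * v $ i)"
      using N v r assms by (subst mult_mat_vec_index) auto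
    also have "\<dots> = (\<Sum>i<n. cnj (M r i) * v $ i)"
      using r assms by (intro sum.cong refl) (simp add: N_def)
    finally have "cnj 0 = cnj (\<Sum>i<n. cnj (M r i) * v $ i)" by simp
    hence "(\<Sum>i<n. cnj (v $ i) * M r i) = 0" by (simp add: mult.commute)
    hence "cnj a * (\<Sum>i<n. cnj (v $ i) * M r i) = 0" by simp
    thus "(\<Sum>i<n. cnj ((a \<cdot>\<^sub>v v) $ i) * M r i) = 0"
      using v(1) by (simp add: sum_distrib_left mult.assoc)
  qed
qed

section \<open>Powers of a diagonalizable matrix\<close>

lemma mat_inv:
  assumes "V \<in> carrier_mat n n" "invertible_mat V"
  shows "mat_inv V \<in> carrier_mat n n" "V * mat_inv V = 1\<^sub>m n" "mat_inv V * V = 1\<^sub>m n"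
proof -
  have "\<exists>U. inverts_mat V U \<and> inverts_mat U V" using assms(2) by (simp add: invertible_mat_def)
  hence U: "inverts_mat V (mat_inv V)" "inverts_mat (mat_inv V) V"
    unfolding mat_inv_def by (metis (mono_tags, lifting) someI_ex)+
  hence 1: "V * mat_inv V = 1\<^sub>m n" and 2: "mat_inv V * V = 1\<^sub>m (dim_row (mat_inv V))"
    using assms by (auto simp: inverts_mat_def)
  \<comment> \<open>The choice of the inverse does not mention its shape, which is read off from the
    two products.\<close>
  have "dim_col (mat_inv V) = n" using arg_cong[OF 1, of dim_col] by simp
  moreover have "dim_row (mat_inv V) = n" using arg_cong[OF 2, of dim_col] assms by simp
  ultimately show "mat_inv V \<in> carrier_mat n n" "V * mat_inv V = 1\<^sub>m n" "mat_inv V * V = 1\<^sub>m n"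
    using 1 2 by auto
qed

lemma diagonal_pow_index:
  fixes D :: "complex mat"
  assumes D: "D \<in> carrier_mat n n" "diagonal_mat D" and ij: "i < n" "j < n"
  shows "(D ^\<^sub>m l) $$ (i, j) = (if i = j then (D $$ (i, i)) ^ l else 0)"
  using ij
proof (induction l arbitrary: j)
  case 0
  then show ?case using D by simp
next
  case (Suc l)
  have "(D ^\<^sub>m Suc l) $$ (i, j) = (\<Sum>r<n. (D ^\<^sub>m l) $$ (i, r) * D $$ (r, j))"
    using D Suc.prems by (subst pow_mat.simps, subst mult_mat_index) auto
  also have "\<dots> = (\<Sum>r<n. if r = i then (D $$ (i, i)) ^ l * D $$ (i, j) else 0)"
    using Suc by (intro sum.cong refl) auto
  also have "\<dots> = (D $$ (i, i)) ^ l * D $$ (i, j)" using ij(1) by (simp add: sum.delta)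
  also have "\<dots> = (if i = j then (D $$ (i, i)) ^ Suc l else 0)"
    using D Suc.prems by (auto simp: diagonal_mat_def)
  finally show ?case .
qed

text \<open>Similarity carries powers of \<open>A\<close> to powers of \<open>D\<close> and
  preserves the characteristic polynomial. The entry formula depends on \<open>l\<close> only
  through powers of diagonal entries, so it can be summed against the coefficients of a
  polynomial.\<close>

lemma diagonalization_consequences:
  fixes A V D :: "complex mat"
  assumes A: "A \<in> carrier_mat n n" and V: "V \<in> carrier_mat n n" "invertible_mat V"
    and D: "D \<in> carrier_mat n n" "diagonal_mat D" and VAV: "V * A * mat_inv V = D"
    and B: "B \<in> carrier_mat n k"
  shows "i < n \<Longrightarrow> c < k \<Longrightarrow>
      (A ^\<^sub>m l * B) $$ (i, c) = (\<Sum>r<n. mat_inv V $$ (i, r) * (D $$ (r, r)) ^ l * (V * B) $$ (r, c))"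
    and "r < n \<Longrightarrow> eigenvalue A (D $$ (r, r))"
proof -
  note U = mat_inv[OF V]
  have "mat_inv V * D * V = mat_inv V * (V * A * mat_inv V * V)"
    unfolding VAV using U(1) D V by simp
  also have "V * A * mat_inv V * V = V * A * (mat_inv V * V)"
    using U(1) V A by (intro assoc_mult_mat[of _ n n _ n _ n]) auto
  also have "\<dots> = V * A" using U(3) V A by simp
  also have "mat_inv V * (V * A) = (mat_inv V * V) * A"
    using U(1) V A by (intro assoc_mult_mat[symmetric, of _ n n _ n _ n]) auto
  also have "\<dots> = A" using U A by simp
  finally have AD: "A = mat_inv V * D * V" ..
  have sim: "similar_mat_wit A D (mat_inv V) V"
    unfolding similar_mat_wit_def Let_def using A D V U AD by auto
  show "eigenvalue A (D $$ (r, r))" if r: "r < n"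
  proof -
    have "char_poly A = char_poly D" using sim by (intro char_poly_similar) (auto simp: similar_mat_def)
    also have "\<dots> = (\<Prod>a\<leftarrow>diag_mat D. [:- a, 1:])"
      using D by (intro char_poly_upper_triangular) (auto simp: upper_triangular_def diagonal_mat_def)
    finally have "poly (char_poly A) (D $$ (r, r)) = 0"
      using r D by (auto simp: poly_prod_list diag_mat_def prod_list_zero_iff)
    thus ?thesis using eigenvalue_root_char_poly[OF A] by simp
  qed
  assume ic: "i < n" "c < k"
  have "A ^\<^sub>m l * B = mat_inv V * D ^\<^sub>m l * V * B"
    using similar_mat_wit_pow_id[OF sim, of l] by simp
  also have "\<dots> = mat_inv V * D ^\<^sub>m l * (V * B)"
    using U V D B by (intro assoc_mult_mat[of _ n n _ n _ k]) auto
  finally have "(A ^\<^sub>m l * B) $$ (i, c) = (\<Sum>r<n. (mat_inv V * D ^\<^sub>m l) $$ (i, r) * (V * B) $$ (r, c))"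
    using ic U V D B by (simp del: index_mult_mat(1) add: mult_mat_index[of i "mat_inv V * D ^\<^sub>m l"])
  also have "\<dots> = (\<Sum>r<n. mat_inv V $$ (i, r) * (D $$ (r, r)) ^ l * (V * B) $$ (r, c))"
  proof (intro sum.cong refl arg_cong2[where f="(*)"])
    fix r assume r: "r \<in> {..<n}"
    have "(mat_inv V * D ^\<^sub>m l) $$ (i, r) = (\<Sum>s<n. mat_inv V $$ (i, s) * (D ^\<^sub>m l) $$ (s, r))"
      using ic r U D by (subst mult_mat_index) auto
    also have "\<dots> = (\<Sum>s<n. if s = r then mat_inv V $$ (i, r) * (D $$ (r, r)) ^ l else 0)"
      using r by (intro sum.cong refl) (auto simp: diagonal_pow_index[OF D])
    finally show "(mat_inv V * D ^\<^sub>m l) $$ (i, r) = mat_inv V $$ (i, r) * (D $$ (r, r)) ^ l"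
      using r by (simp add: sum.delta)
  qed
  finally show "(A ^\<^sub>m l * B) $$ (i, c) = (\<Sum>r<n. mat_inv V $$ (i, r) * (D $$ (r, r)) ^ l * (V * B) $$ (r, c))" .
qed

text \<open>Three separate estimates multiply: the row \<open>y\<close>, the adjoint of
  \<open>x\<close> times the inverse of \<open>V\<close>, is bounded by the spectral norm of that
  inverse; the values of \<open>p\<close> on the diagonal by \<open>b\<close>; and
  \<open>V * B\<close> by the spectral norm of \<open>V\<close> times the Frobenius norm of
  \<open>B\<close>.\<close>

theorem lambda_min_gramian_poly_bound:
  fixes A B V D :: "complex mat" and p :: "complex poly"
  assumes A: "A \<in> carrier_mat n n" and V: "V \<in> carrier_mat n n" "invertible_mat V"
    and D: "D \<in> carrier_mat n n" "diagonal_mat D" and VAV: "V * A * mat_inv V = D"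
    and B: "B \<in> carrier_mat n k" and t: "k * t < n" and k: "k > 0"
    and p: "degree p = t" "lead_coeff p = 1"
    and b: "\<And>e. eigenvalue A e \<Longrightarrow> cmod (poly p e) \<le> b"
  shows "lambda_min (ctrl_gramian A B t) \<le> (cond_num V)\<^sup>2 * (frob_norm B)\<^sup>2 * b\<^sup>2"
proof -
  define U where "U = mat_inv V"
  note U = mat_inv[OF V, folded U_def]
  define C where "C = V * B"
  have C: "dim_row C = n" "dim_col C = k" using V B by (auto simp: C_def)
  define d where "d r = D $$ (r, r)" for r
  \<comment> \<open>The index \<open>r = l * k + c\<close> enumerates the columns
    \<open>c < k\<close> of the blocks \<open>l < t\<close>: \<open>k * t\<close> conditions, fewer
    than the dimension.\<close>
  obtain x where x: "x \<in> carrier_vec n" "vec_2norm x = 1"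
    and orth: "\<And>r. r < k * t \<Longrightarrow> (\<Sum>i<n. cnj (x $ i) * (A ^\<^sub>m (r div k) * B) $$ (i, r mod k)) = 0"
    by (rule unit_vec_orthogonal[OF t, of "\<lambda>r i. (A ^\<^sub>m (r div k) * B) $$ (i, r mod k)"]) (rule that)
  define s where "s l c = (\<Sum>i<n. cnj (x $ i) * (A ^\<^sub>m l * B) $$ (i, c))" for l c
  have s0: "s l c = 0" if "l < t" "c < k" for l c
  proof -
    have "l * k + c < k * t"
    proof -
      have "l * k + c < Suc l * k" using that by simp
      also have "\<dots> \<le> t * k" using that by (intro mult_right_mono) auto
      finally show ?thesis by (simp add: mult.commute)
    qed
    from orth[OF this] show ?thesis using that k by (simp add: s_def)
  qed
  define y where "y r = (\<Sum>i<n. cnj (x $ i) * U $$ (i, r))" for r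
  have sy: "s l c = (\<Sum>r<n. y r * (d r) ^ l * C $$ (r, c))" if "c < k" for l c
  proof -
    have "s l c = (\<Sum>i<n. \<Sum>r<n. cnj (x $ i) * (U $$ (i, r) * (d r) ^ l * C $$ (r, c)))"
      unfolding s_def U_def C_def d_def sum_distrib_left[symmetric]
      by (intro sum.cong refl arg_cong2[where f="(*)"] diagonalization_consequences(1)[OF A V D VAV B])
         (use that in auto)
    also have "\<dots> = (\<Sum>r<n. \<Sum>i<n. cnj (x $ i) * (U $$ (i, r) * (d r) ^ l * C $$ (r, c)))"
      by (rule sum.swap)
    finally show ?thesis by (simp add: y_def sum_distrib_right mult.assoc)
  qed
  have st: "s t c = (\<Sum>r<n. y r * (poly p (d r) * C $$ (r, c)))" if c: "c < k" for c
  proof -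
    have "(\<Sum>r<n. y r * (poly p (d r) * C $$ (r, c)))
        = (\<Sum>r<n. \<Sum>l\<le>t. coeff p l * (y r * (d r) ^ l * C $$ (r, c)))"
      unfolding poly_altdef p(1) by (simp add: sum_distrib_left sum_distrib_right mult_ac)
    also have "\<dots> = (\<Sum>l\<le>t. coeff p l * s l c)"
      by (subst sum.swap) (simp add: sy[OF c] sum_distrib_left)
    \<comment> \<open>The lower coefficients of \<open>p\<close> meet sums that vanish by
      orthogonality, and the leading coefficient is 1.\<close>
    also have "\<dots> = (\<Sum>l\<le>t. if l = t then s t c else 0)"
      using p s0[OF _ c] by (intro sum.cong refl) auto
    finally show ?thesis by simp
  qed
  have b0: "cmod (poly p (d r)) \<le> b" if "r < n" for r
    unfolding d_def using that by (intro b diagonalization_consequences(2)[OF A V D VAV B])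
  have Y: "(\<Sum>r<n. (cmod (y r))\<^sup>2) \<le> (spec_norm U)\<^sup>2"
    using spec_norm_bound_adjoint[of x U] x U(1) by (simp add: y_def)
  have "lambda_min (ctrl_gramian A B t) \<le> (\<Sum>l\<le>t. \<Sum>c<k. (cmod (s l c))\<^sup>2)"
    unfolding s_def by (rule lambda_min_gramian_le[OF A B x])
  also have "\<dots> = (\<Sum>l\<le>t. if l = t then \<Sum>c<k. (cmod (s t c))\<^sup>2 else 0)"
    using s0 by (intro sum.cong refl) auto
  also have "\<dots> = (\<Sum>c<k. (cmod (s t c))\<^sup>2)" by simp
  also have "\<dots> \<le> (\<Sum>c<k. (spec_norm U)\<^sup>2 * (b\<^sup>2 * (\<Sum>r<n. (cmod (C $$ (r, c)))\<^sup>2)))"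
  proof (rule sum_mono)
    fix c assume c: "c \<in> {..<k}"
    have "(cmod (s t c))\<^sup>2 \<le> (\<Sum>r<n. (cmod (y r))\<^sup>2) * (\<Sum>r<n. (cmod (poly p (d r) * C $$ (r, c)))\<^sup>2)"
      using c by (subst st) (auto intro!: cmod_sum_mult_sq_le)
    also have "\<dots> \<le> (spec_norm U)\<^sup>2 * (b\<^sup>2 * (\<Sum>r<n. (cmod (C $$ (r, c)))\<^sup>2))"
    proof (intro mult_mono Y)
      show "(\<Sum>r<n. (cmod (poly p (d r) * C $$ (r, c)))\<^sup>2) \<le> b\<^sup>2 * (\<Sum>r<n. (cmod (C $$ (r, c)))\<^sup>2)"
        unfolding sum_distrib_left norm_mult power_mult_distrib
        by (intro sum_mono mult_right_mono power_mono b0) auto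
    qed (auto intro!: sum_nonneg)
    finally show "(cmod (s t c))\<^sup>2 \<le> (spec_norm U)\<^sup>2 * (b\<^sup>2 * (\<Sum>r<n. (cmod (C $$ (r, c)))\<^sup>2))" .
  qed
  also have "\<dots> = (spec_norm U)\<^sup>2 * (b\<^sup>2 * (frob_norm C)\<^sup>2)"
  proof -
    have "(frob_norm C)\<^sup>2 = (\<Sum>c<k. \<Sum>r<n. (cmod (C $$ (r, c)))\<^sup>2)"
      unfolding frob_norm_sq C by (rule sum.swap)
    thus ?thesis by (simp add: sum_distrib_left)
  qed
  also have "\<dots> \<le> (spec_norm U)\<^sup>2 * (b\<^sup>2 * ((spec_norm V)\<^sup>2 * (frob_norm B)\<^sup>2))"
    unfolding C_def using V B by (intro mult_left_mono frob_norm_mult_le) auto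
  also have "\<dots> = (cond_num V)\<^sup>2 * (frob_norm B)\<^sup>2 * b\<^sup>2"
    by (simp add: cond_num_def U_def power_mult_distrib mult_ac)
  finally show ?thesis .
qed

section \<open>Polynomials small on a compact set\<close>

lemma prob_measures_on_empty: "prob_measures_on {} = {}"
proof -
  have False if "\<mu> \<in> prob_measures_on {}" for \<mu>
  proof -
    have "prob_space \<mu>" "space \<mu> = UNIV" "emeasure \<mu> UNIV = 0"
      using that sets_eq_imp_space_eq[of \<mu> borel] by (auto simp: prob_measures_on_def)
    thus False using prob_space.emeasure_space_1[of \<mu>] by simp
  qed
  thus ?thesis by blast
qed

text \<open>Positivity excludes minus infinity, and with it the empty set, where the supremum runs
  over no measure; boundedness of \<open>X\<close> excludes plus infinity.\<close>

lemma log_capacity_posE: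
  assumes "compact X" "log_capacity X > 0"
  obtains I where "log_energy_sup X = ereal I" "log_capacity X = exp I" "X \<noteq> {}"
proof -
  have ne: "log_energy_sup X \<noteq> -\<infinity>" using assms(2) by (auto simp: log_capacity_def)
  obtain B where B: "\<And>x. x \<in> X \<Longrightarrow> cmod x \<le> B"
    using compact_imp_bounded[OF assms(1)] by (auto simp: bounded_iff)
  have "log_energy_sup X \<le> ereal (ln (max 1 (2 * B)))"
  proof (rule log_energy_sup_le)
    show "X \<in> sets borel" using assms(1) by (simp add: compact_imp_closed)
    show "cmod (x - y) \<le> exp (ln (max 1 (2 * B)))" if "x \<in> X" "y \<in> X" for x y
      using B[OF that(1)] B[OF that(2)] norm_triangle_ineq4[of x y] by simp
  qed simp
  with ne obtain I where I: "log_energy_sup X = ereal I"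
    by (cases "log_energy_sup X") auto
  have "X \<noteq> {}"
    using ne by (auto simp: log_energy_sup_def prob_measures_on_empty bot_ereal_def)
  with I show ?thesis by (intro that[of I]) (auto simp: log_capacity_def)
qed

lemma eventually_fekete_le:
  assumes X: "compact X" "X \<noteq> {}" and c: "log_energy_sup X < ereal c"
    and z: "\<And>m i. i < m \<Longrightarrow> z m i \<in> X"
  shows "\<forall>\<^sub>F m in sequentially. pair_prod m (z m) \<le> exp (c * (real m * (real m - 1)))"
proof (rule ccontr)
  assume *: "\<not> ?thesis"
  have "\<exists>m>N. \<exists>z. (\<forall>i<m. z i \<in> X) \<and> pair_prod m z \<ge> exp (c * (real m * (real m - 1)))" for N
  proof -
    from * obtain m where "m > N" "\<not> pair_prod m (z m) \<le> exp (c * (real m * (real m - 1)))"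
      unfolding eventually_sequentially by (meson Suc_le_eq)
    thus ?thesis using z by (intro exI[of _ m]) (auto intro!: exI[of _ "z m"])
  qed
  from log_energy_sup_ge_of_frequently[OF X this] c show False by simp
qed

text \<open>Among \<open>Suc t\<close> points there are \<open>t * Suc t\<close> ordered pairs, and
  \<open>r t\<close> is the root of that order of the maximal product. This makes the bound an exact
  \<open>t\<close>-th power, so only the asymptotics of \<open>r\<close> remain to be compared with
  the capacity.\<close>

lemma monic_polys_small_on_compact:
  assumes X: "compact X" and cap: "log_capacity X > 0"
  obtains r :: "nat \<Rightarrow> real" and p :: "nat \<Rightarrow> complex poly" where
    "\<And>t. r t \<ge> 0" "\<And>t. degree (p t) = t" "\<And>t. lead_coeff (p t) = 1"
    "\<And>t w. w \<in> X \<Longrightarrow> cmod (poly (p t) w) \<le> r t ^ t"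
    "\<And>a. a > log_capacity X \<Longrightarrow> \<forall>\<^sub>F t in sequentially. r t \<le> a"
proof -
  obtain I where I: "log_energy_sup X = ereal I" "log_capacity X = exp I" and ne: "X \<noteq> {}"
    by (rule log_capacity_posE[OF assms]) (rule that)
  have "\<exists>z. (\<forall>i<m. z i \<in> X) \<and>
      (\<forall>w. (\<forall>i<m. w i \<in> X) \<longrightarrow> pair_prod m w \<le> pair_prod m z)" for m
    by (rule fekete_points_exist[OF X ne, of m]) blast
  then obtain z where z: "\<And>m i. i < m \<Longrightarrow> z m i \<in> X"
    and zmax: "\<And>m w. (\<And>i. i < m \<Longrightarrow> w i \<in> X) \<Longrightarrow> pair_prod m w \<le> pair_prod m (z m)"
    by metis
  define F where "F m = pair_prod m (z m)" for m
  have F0: "F m \<ge> 0" for m by (simp add: F_def pair_prod_nonneg)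
  have "\<exists>p. degree p = t \<and> lead_coeff p = 1 \<and> (\<forall>w\<in>X. cmod (poly p w) ^ Suc t \<le> F (Suc t))" for t
    unfolding F_def by (rule small_monic_poly_of_fekete[OF z zmax, of t]) blast+
  then obtain p where p: "\<And>t. degree (p t) = t" "\<And>t. lead_coeff (p t) = 1"
    "\<And>t w. w \<in> X \<Longrightarrow> cmod (poly (p t) w) ^ Suc t \<le> F (Suc t)" by metis
  define r where "r t = F (Suc t) powr (1 / (real t * real (Suc t)))" for t
  have r0: "r t \<ge> 0" for t by (simp add: r_def)
  have rF: "(r t ^ t) ^ Suc t = F (Suc t)" for t
  proof (cases "t = 0")
    case True
    \<comment> \<open>A single point has no pairs, so \<open>F 1\<close> is an empty product, and
      the left side is 1 whatever \<open>r 0\<close> is.\<close>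
    thus ?thesis by (simp add: F_def pair_prod_def)
  next
    case False
    show ?thesis
    proof (cases "F (Suc t) = 0")
      case True
      thus ?thesis using False by (simp add: r_def)
    next
      case F: False
      hence pos: "F (Suc t) > 0" using F0[of "Suc t"] by simp
      have "(r t ^ t) ^ Suc t = r t ^ (t * Suc t)" by (simp only: power_mult)
      also have "\<dots> = r t powr (real (t * Suc t))"
        using pos by (intro powr_realpow[symmetric]) (simp add: r_def)
      also have "\<dots> = F (Suc t) powr 1"
        unfolding r_def powr_powr of_nat_mult using False
        by (intro arg_cong[where f="(powr) (F (Suc t))"]) (simp del: of_nat_Suc)
      finally show ?thesis using pos by simp
    qed
  qed
  show ?thesis
  proof (rule that[of r p, OF r0 p(1,2)])
    show "cmod (poly (p t) w) \<le> r t ^ t" if "w \<in> X" for t w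
      using p(3)[OF that, of t] unfolding rF[symmetric]
      by (rule power_le_imp_le_base) (simp add: r0)
    fix a assume a: "a > log_capacity X"
    hence a0: "a > 0" using cap by simp
    have "I < ln a" using a a0 exp_less_cancel_iff[of I "ln a"] by (simp add: I(2))
    hence "log_energy_sup X < ereal (ln a)" by (simp add: I)
    hence "\<forall>\<^sub>F m in sequentially. F m \<le> exp (ln a * (real m * (real m - 1)))"
      unfolding F_def using z by (intro eventually_fekete_le[OF X ne]) auto
    hence "\<forall>\<^sub>F m in sequentially. F (Suc m) \<le> exp (ln a * (real (Suc m) * (real (Suc m) - 1)))"
      by (subst eventually_sequentially_Suc)
    with eventually_gt_at_top[of 0] show "\<forall>\<^sub>F t in sequentially. r t \<le> a"
    proof eventually_elim
      case (elim t)
      have "r t \<le> exp (ln a * (real (Suc t) * (real (Suc t) - 1))) powr (1 / (real t * real (Suc t)))"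
        unfolding r_def using elim F0 by (intro powr_mono2) auto
      also have "\<dots> = exp (ln a)"
      proof -
        have "1 / (real t * real (Suc t)) * (ln a * (real (Suc t) * (real (Suc t) - 1))) = ln a"
          using elim(1) by (simp add: divide_simps del: of_nat_Suc)
        thus ?thesis by (simp only: powr_def ln_exp exp_not_eq_zero if_False)
      qed
      finally show ?case using a0 by simp
    qed
  qed
qed

lemma t_min_less:
  assumes "n \<ge> 1" "k \<ge> 1"
  shows "k * (nat \<lceil>real n / real k\<rceil> - 1) < n"
proof -
  have pos: "real n / real k > 0" using assms by simp
  \<comment> \<open>Ensures that the subtraction on \<open>nat\<close> does not truncate.\<close>
  hence "nat \<lceil>real n / real k\<rceil> \<ge> 1" by linarith
  hence "real (nat \<lceil>real n / real k\<rceil> - 1) < real n / real k" using pos by linarith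
  hence "real k * real (nat \<lceil>real n / real k\<rceil> - 1) < real n" using assms by (simp add: field_simps)
  thus ?thesis by (simp flip: of_nat_mult)
qed

theorem theorem1:
  fixes X :: "complex set"
  assumes "compact X" and "log_capacity X > 0"
  shows "\<exists>eps :: nat \<Rightarrow> real. eps \<longlonglongrightarrow> 0 \<and>
    (\<forall>(n::nat) (k::nat) (A::complex mat) (B::complex mat) (V::complex mat) (D::complex mat).
       n \<ge> 1 \<longrightarrow> k \<ge> 1 \<longrightarrow>
       A \<in> carrier_mat n n \<longrightarrow> V \<in> carrier_mat n n \<longrightarrow> D \<in> carrier_mat n n \<longrightarrow>
       B \<in> carrier_mat n k \<longrightarrow>
       invertible_mat V \<longrightarrow> diagonal_mat D \<longrightarrow> V * A * mat_inv V = D \<longrightarrow>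
       (\<forall>e. eigenvalue A e \<longrightarrow> e \<in> X) \<longrightarrow>
       (let t = nat \<lceil>real n / real k\<rceil> - 1 in
         lambda_min (ctrl_gramian A B t)
           \<le> (cond_num V)\<^sup>2 * (frob_norm B)\<^sup>2 * ((1 + eps t) * (log_capacity X)\<^sup>2) ^ t))"
proof -
  define cap where "cap = log_capacity X"
  have cap: "cap > 0" using assms(2) by (simp add: cap_def)
  obtain r :: "nat \<Rightarrow> real" and p :: "nat \<Rightarrow> complex poly" where r0: "\<And>t. r t \<ge> 0"
    and p: "\<And>t. degree (p t) = t" "\<And>t. lead_coeff (p t) = 1"
      "\<And>t w. w \<in> X \<Longrightarrow> cmod (poly (p t) w) \<le> r t ^ t"
    and ev: "\<And>a. a > log_capacity X \<Longrightarrow> \<forall>\<^sub>F t in sequentially. r t \<le> a"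
    by (rule monic_polys_small_on_compact[OF assms]) (rule that)
  \<comment> \<open>The growth of \<open>r\<close> is controlled only from above; clipping at 0
    turns this into convergence.\<close>
  define eps where "eps t = max 0 ((r t / cap)\<^sup>2 - 1)" for t
  have "eps \<longlonglongrightarrow> 0"
  proof (rule order_tendstoI)
    fix e :: real assume "e < 0"
    thus "\<forall>\<^sub>F t in sequentially. e < eps t" by (auto simp: eps_def less_max_iff_disj)
  next
    fix e :: real assume e: "e > 0"
    \<comment> \<open>Chosen so that \<open>r t \<le> cap * sqrt (1 + e / 2)\<close> yields
      \<open>eps t \<le> e / 2\<close>.\<close>
    have "sqrt (1 + e / 2) > 1" using e by simp
    hence "cap * sqrt (1 + e / 2) > cap" using cap by simp
    from ev[OF this[unfolded cap_def], folded cap_def] show "\<forall>\<^sub>F t in sequentially. eps t < e"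
    proof eventually_elim
      case (elim t)
      hence "r t / cap \<le> sqrt (1 + e / 2)" using cap by (simp add: field_simps)
      hence "(r t / cap)\<^sup>2 \<le> (sqrt (1 + e / 2))\<^sup>2" using cap r0 by (intro power_mono) auto
      thus ?case using e by (simp add: eps_def)
    qed
  qed
  moreover have "lambda_min (ctrl_gramian A B t)
           \<le> (cond_num V)\<^sup>2 * (frob_norm B)\<^sup>2 * ((1 + eps t) * cap\<^sup>2) ^ t"
    if "n \<ge> 1" "k \<ge> 1" and A: "A \<in> carrier_mat n n" and V: "V \<in> carrier_mat n n" "invertible_mat V"
      and D: "D \<in> carrier_mat n n" "diagonal_mat D" and VAV: "V * A * mat_inv V = D"
      and B: "B \<in> carrier_mat n k" and eig: "\<forall>e. eigenvalue A e \<longrightarrow> e \<in> X"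
      and t: "t = nat \<lceil>real n / real k\<rceil> - 1"
    for n k t :: nat and A B V D
  proof -
    have "(r t)\<^sup>2 \<le> (1 + eps t) * cap\<^sup>2"
    proof -
      have "(r t / cap)\<^sup>2 \<le> 1 + eps t" by (simp add: eps_def)
      thus ?thesis using cap by (simp add: power_divide field_simps)
    qed
    hence "((r t)\<^sup>2) ^ t \<le> ((1 + eps t) * cap\<^sup>2) ^ t" by (intro power_mono) auto
    moreover have "((r t)\<^sup>2) ^ t = (r t ^ t)\<^sup>2" by (simp flip: power_mult add: mult.commute)
    moreover have "lambda_min (ctrl_gramian A B t) \<le> (cond_num V)\<^sup>2 * (frob_norm B)\<^sup>2 * (r t ^ t)\<^sup>2"
      using that t_min_less[of n k] eig
      by (intro lambda_min_gramian_poly_bound[OF A V D VAV B _ _ p(1,2)] p(3)) auto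
    ultimately show ?thesis
      by (smt (verit) mult_left_mono zero_le_mult_iff zero_le_power2)
  qed
  ultimately show ?thesis unfolding Let_def cap_def by (intro exI[of _ eps]) blast
qed

end
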